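(* Let $m\ge2$, $2\le p<\infty$, and let $A_1,\ldots,A_m\in\mathbb M_n(\mathbb C)$ have rank at most one and not all vanish. Then \[ \left\|\sum_{k=1}^m A_k\right\|_p\le C^{\mathrm{TZ}}_{p,m}\left\|\sum_{k=1}^m |A_k|\right\|_p . \] The constant is sharp in the dimension-free rank-one problem and is attained whenever $n\ge m$. Equality holds precisely as follows, up to common input and output unitaries, a common positive scale, and the harmless phase changes in rank-one factorizations: \[ A_k=r\,u v_k^*,\qquad \langle v_j,v_k\rangle=\begin{cases}1,&j=k,\\ s_{p,m},&j\ne k,\end{cases} \] where $r>0$, $u$ is a unit vector, and \[ s_{p,m}=\frac{x_{p,m}-1}{x_{p,m}+m-1}. \] In particular, equality requires $n\ge m$.
   Context: $\mathbb M_n(\mathbb C)$ denotes the complex $n\times n$ matrices. For $A\in\mathbb M_n(\mathbb C)$, $|A|=(A^*A)^{1/2}$, and $\|A\|_p=(\operatorname{Tr}|A|^p)^{1/p}$ is the Schatten $p$-norm for $1\le p<\infty$. For finite $p>1$ and an integer $m\ge2$, let $x_{p,m}>1$ be the unique solution of $x^p-2x-(m-1)=0$ with $x>1$, and define \[ C^{\mathrm{TZ}}_{p,m}=\frac{\sqrt{x_{p,m}(x_{p,m}+m-1)}}{(x_{p,m}^p+m-1)^{1/p}}. \] The dimension-free rank-one problem is to find the best constant in the inequality $\|\sum_{k=1}^m A_k\|_p\le c\,\|\sum_{k=1}^m|A_k|\|_p$ valid for all $n\ge1$ and all families of $m$ matrices of rank at most one in $\mathbb M_n(\mathbb C)$,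 not all zero. A rank-one factorization of $A_k$ is an expression $A_k=r_ku_kv_k^*$ with $r_k\ge0$ and $u_k,v_k$ unit vectors whenever $r_k>0$. *)

theory Defs
  imports
    Complex_Main
    "Jordan_Normal_Form.DL_Rank"
    "Jordan_Normal_Form.Schur_Decomposition"
begin

definition unitary_mat :: "nat \<Rightarrow> complex mat \<Rightarrow> bool" where
  "unitary_mat n U \<longleftrightarrow>
     U \<in> carrier_mat n n \<and> mat_adjoint U * U = 1\<^sub>m n \<and> U * mat_adjoint U = 1\<^sub>m n"

text \<open>
  Real power of a positive semidefinite matrix by functional calculus on a unitary
  diagonalization; the result does not depend on the diagonalization. Since
  \<open>0 powr t = 0\<close>, the kernel is preserved for \<open>t > 0\<close>. The value is
  unspecified if the argument is not positive semidefinite.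
\<close>
definition mat_rpow :: "complex mat \<Rightarrow> real \<Rightarrow> complex mat" where
  "mat_rpow A t = (THE B. \<exists>U d.
     unitary_mat (dim_row A) U \<and> (\<forall>i<dim_row A. (d i :: real) \<ge> 0) \<and>
     A = U * mat_diag (dim_row A) (\<lambda>i. complex_of_real (d i)) * mat_adjoint U \<and>
     B = U * mat_diag (dim_row A) (\<lambda>i. complex_of_real (d i powr t)) * mat_adjoint U)"

definition mat_abs :: "complex mat \<Rightarrow> complex mat" where
  "mat_abs A = mat_rpow (mat_adjoint A * A) (1 / 2)"

definition mat_trace :: "complex mat \<Rightarrow> complex" where
  "mat_trace A = (\<Sum>i<dim_row A. A $$ (i, i))"

text \<open>The trace below is that of a positive semidefinite matrix, hence real and nonnegative.\<close>
definition schatten_norm :: "real \<Rightarrow> complex mat \<Rightarrow> real" where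
  "schatten_norm p A = Re (mat_trace (mat_rpow (mat_abs A) p)) powr (1 / p)"

text \<open>
  The sum \<open>A 0 + \<dots> + A (m - 1)\<close> of \<open>n \<times> n\<close> matrices, written entrywise because the
  type of matrices carries no global zero. Families of \<open>m\<close> matrices are indexed from \<open>0\<close>.
\<close>
definition msum :: "nat \<Rightarrow> nat \<Rightarrow> (nat \<Rightarrow> complex mat) \<Rightarrow> complex mat" where
  "msum n m A = mat n n (\<lambda>(i, j). \<Sum>k<m. A k $$ (i, j))"

definition rank_one_family :: "nat \<Rightarrow> nat \<Rightarrow> (nat \<Rightarrow> complex mat) \<Rightarrow> bool" where
  "rank_one_family n m A \<longleftrightarrow>
     (\<forall>k<m. A k \<in> carrier_mat n n \<and> vec_space.rank n (A k) \<le> 1) \<and>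
     (\<exists>k<m. A k \<noteq> 0\<^sub>m n n)"

definition tz_x :: "real \<Rightarrow> nat \<Rightarrow> real" where
  "tz_x p m = (THE x. x > 1 \<and> x powr p - 2 * x - (real m - 1) = 0)"

definition tz_const :: "real \<Rightarrow> nat \<Rightarrow> real" where
  "tz_const p m =
     sqrt (tz_x p m * (tz_x p m + real m - 1)) / (tz_x p m powr p + real m - 1) powr (1 / p)"

definition tz_s :: "real \<Rightarrow> nat \<Rightarrow> real" where
  "tz_s p m = (tz_x p m - 1) / (tz_x p m + real m - 1)"

text \<open>The matrix \<open>u v\<^sup>*\<close>.\<close>
definition outer_prod :: "complex vec \<Rightarrow> complex vec \<Rightarrow> complex mat" where
  "outer_prod u v = mat (dim_vec u) (dim_vec v) (\<lambda>(i, j). u $ i * cnj (v $ j))"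

text \<open>
  The set of these families is closed under \<open>A k \<mapsto> c W (A k) V\<close> with \<open>W\<close>, \<open>V\<close> unitary and
  \<open>c > 0\<close> (replace \<open>r\<close>, \<open>u\<close>, \<open>v k\<close> by \<open>c r\<close>, \<open>W u\<close>, \<open>V\<^sup>* (v k)\<close>), and a simultaneous phase
  change of the two vectors of a rank-one factorization does not change \<open>A k\<close>. So the
  existential quantifiers already express ``up to common input and output unitaries, a
  common positive scale and phase changes''.
\<close>
definition tz_extremal :: "real \<Rightarrow> nat \<Rightarrow> nat \<Rightarrow> (nat \<Rightarrow> complex mat) \<Rightarrow> bool" where
  "tz_extremal p n m A \<longleftrightarrow>
     (\<exists>(r::real) u v.
        r > 0 \<and> u \<in> carrier_vec n \<and> u \<bullet>c u = 1 \<and>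
        (\<forall>k<m. v k \<in> carrier_vec n \<and> A k = complex_of_real r \<cdot>\<^sub>m outer_prod u (v k)) \<and>
        (\<forall>j<m. \<forall>k<m. v j \<bullet>c v k = (if j = k then 1 else complex_of_real (tz_s p m))))"

end

theory Submission
  imports Defs
begin

text \<open>
  Why the theorem is true. Write each \<open>A k\<close> as \<open>x w\<^sup>*\<close> with factors of equal norm; then its absolute
  value is \<open>w w\<^sup>*\<close>. Collecting the factors as columns of \<open>n \<times> m\<close> matrices \<open>X\<close> and \<open>V\<close>, one has to compare
  \<open>X V\<^sup>*\<close> with \<open>V V\<^sup>*\<close>, where corresponding columns of \<open>X\<close> and \<open>V\<close> have the same norm. Let \<open>G = V\<^sup>* V\<close>, an
  \<open>m \<times> m\<close> matrix with the same nonzero eigenvalues as \<open>V V\<^sup>*\<close>, let \<open>\<lambda>\<close> be its largest eigenvalue and \<open>T\<close>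
  its trace. Since \<open>p \<ge> 2\<close>,

  \<open>\<parallel>X V\<^sup>*\<parallel>\<^sub>p\<^sup>2 \<le> \<parallel>X V\<^sup>*\<parallel>\<^sub>2\<^sup>2 \<le> \<lambda> \<parallel>X\<parallel>\<^sub>2\<^sup>2 = \<lambda> \<parallel>V\<parallel>\<^sub>2\<^sup>2 = \<lambda> T\<close>.

  What remains is a problem about \<open>m\<close> nonnegative numbers \<open>g\<close>, the eigenvalues of \<open>G\<close>: to bound one
  of them times their sum by a multiple of \<open>(\<Sum>k<m. g k powr p) powr (2 / p)\<close>. The optimum is attained
  when the chosen number is \<open>x\<close> times the others, which are equal, and the critical point equation is
  \<open>x powr p = 2 x + m - 1\<close>; the best factor is the square of the constant of the theorem
  (\<open>tz_scalar_bound\<close>, \<open>factored_bound\<close>).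

  Equality forces equality everywhere in this chain. The scalar problem fixes the spectrum of \<open>G\<close> up
  to scale: a simple eigenvalue \<open>\<lambda> = x \<nu>\<close> and otherwise \<open>\<nu> > 0\<close>. In particular \<open>G\<close> is invertible, so
  \<open>m \<le> n\<close>. Equality in the second step confines the conjugated rows of \<open>X\<close> to the eigenspace of
  \<open>\<lambda>\<close>, which is a line; so all left factors are multiples of one vector, and the condition on the column norms makes all entries of the
  top eigenvector equal in modulus. This is the extremal configuration
  (\<open>equality_imp_tz_extremal\<close>). Conversely both norms can be computed for an extremal family
  (\<open>tz_extremal_imp_equality\<close>), and extremal families exist as soon as \<open>m\<close> equiangular
  vectors fit into the space, that is, for \<open>n \<ge> m\<close>.
\<close>

section \<open>Entrywise matrix algebra\<close>

lemma mat_adjoint_carrier [simp, intro]: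
  "A \<in> carrier_mat n m \<Longrightarrow> mat_adjoint A \<in> carrier_mat m n"
  unfolding mat_adjoint_def by auto

lemma mat_adjoint_dim [simp]:
  "dim_row (mat_adjoint A) = dim_col A" "dim_col (mat_adjoint A) = dim_row A"
  unfolding mat_adjoint_def by auto

lemma mat_adjoint_index:
  fixes A :: "complex mat"
  assumes "i < dim_col A" "j < dim_row A"
  shows "mat_adjoint A $$ (i, j) = cnj (A $$ (j, i))"
  using assms unfolding mat_adjoint_def by (simp add: mat_of_rows_index)

lemma mat_mult_index:
  assumes "A \<in> carrier_mat n k" "B \<in> carrier_mat k m" "i < n" "j < m"
  shows "(A * B) $$ (i, j) = (\<Sum>l<k. A $$ (i, l) * B $$ (l, j))"
  using assms by (auto simp: scalar_prod_def lessThan_atLeast0 intro!: sum.cong)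

lemma mat_adjoint_adjoint [simp]: "mat_adjoint (mat_adjoint (A :: complex mat)) = A"
  by (rule eq_matI) (auto simp: mat_adjoint_index)

lemma mat_adjoint_mult:
  fixes A B :: "complex mat"
  assumes A: "A \<in> carrier_mat n k" and B: "B \<in> carrier_mat k m"
  shows "mat_adjoint (A * B) = mat_adjoint B * mat_adjoint A"
proof (rule eq_matI)
  fix i j assume ij: "i < dim_row (mat_adjoint B * mat_adjoint A)"
    "j < dim_col (mat_adjoint B * mat_adjoint A)"
  hence i: "i < m" and j: "j < n" using A B by auto
  have "mat_adjoint (A * B) $$ (i, j) = (\<Sum>l<k. cnj (A $$ (j, l) * B $$ (l, i)))"
    using A B i j by (simp add: mat_adjoint_index mat_mult_index[OF A B j i] cnj_sum
        del: index_mult_mat(1))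
  also have "\<dots> = (mat_adjoint B * mat_adjoint A) $$ (i, j)"
    using A B i j
    by (subst mat_mult_index[of _ m k _ n]) (auto simp: mat_adjoint_index mult.commute intro!: sum.cong)
  finally show "mat_adjoint (A * B) $$ (i, j) = (mat_adjoint B * mat_adjoint A) $$ (i, j)" .
qed (use A B in auto)

lemma unitary_mat_carrier [simp]: "unitary_mat n U \<Longrightarrow> U \<in> carrier_mat n n"
  by (simp add: unitary_mat_def)

lemma unitary_mat_cancel:
  assumes "unitary_mat n U"
  shows "A \<in> carrier_mat k n \<Longrightarrow> A * U * mat_adjoint U = A"
    and "A \<in> carrier_mat n k \<Longrightarrow> U * (mat_adjoint U * A) = A"
    and "A \<in> carrier_mat n k \<Longrightarrow> mat_adjoint U * (U * A) = A"
  using assms unfolding unitary_mat_def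
  by (simp_all add: assoc_mult_mat[of A k n U n _ n]
      assoc_mult_mat[of U n n _ n A k, symmetric] assoc_mult_mat[of _ n n U n A k, symmetric])

lemma unitary_mat_I:
  assumes U: "U \<in> carrier_mat n n" and UU: "mat_adjoint U * U = 1\<^sub>m n"
  shows "unitary_mat n U"
  unfolding unitary_mat_def
  using U UU mat_mult_left_right_inverse[OF mat_adjoint_carrier[OF U] U UU] by simp

lemma mat_adjoint_one [simp]: "mat_adjoint (1\<^sub>m n) = (1\<^sub>m n :: complex mat)"
  by (rule eq_matI) (auto simp: mat_adjoint_index)

lemma unitary_mat_one: "unitary_mat n (1\<^sub>m n)"
  by (rule unitary_mat_I) auto

lemma unitary_mat_mult:
  assumes U: "unitary_mat n U" and V: "unitary_mat n V"
  shows "unitary_mat n (U * V)"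
proof (rule unitary_mat_I)
  have c: "U \<in> carrier_mat n n" "V \<in> carrier_mat n n" using U V by auto
  show "U * V \<in> carrier_mat n n" using c by auto
  have "mat_adjoint (U * V) * (U * V) = mat_adjoint V * (mat_adjoint U * (U * V))"
    unfolding mat_adjoint_mult[OF c]
    by (rule assoc_mult_mat[of _ n n _ n _ n]) (use c in auto)
  also have "\<dots> = 1\<^sub>m n"
    using unitary_mat_cancel(3)[OF U c(2)] V by (simp add: unitary_mat_def)
  finally show "mat_adjoint (U * V) * (U * V) = 1\<^sub>m n" .
qed

text \<open>
  Dimension side conditions, unlike carrier memberships with an unknown inner dimension, can be
  discharged by rewriting; so this form serves as a rewrite rule for long products.
\<close>
lemma mat_mult_assoc:
  fixes A B C :: "complex mat"
  assumes "dim_col A = dim_row B" "dim_col B = dim_row C"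
  shows "A * B * C = A * (B * C)"
  using assms by (intro assoc_mult_mat[of A "dim_row A" "dim_row B" B "dim_row C" C "dim_col C"]) auto

lemma mat_adjoint_times:
  fixes A B :: "complex mat"
  assumes "dim_col A = dim_row B"
  shows "mat_adjoint (A * B) = mat_adjoint B * mat_adjoint A"
  using assms by (intro mat_adjoint_mult[of A "dim_row A" "dim_row B" B "dim_col B"]) auto

lemma unitary_mat_rewrites:
  assumes "unitary_mat n U"
  shows "dim_row A = n \<Longrightarrow> U * (mat_adjoint U * A) = A"
    and "dim_row A = n \<Longrightarrow> mat_adjoint U * (U * A) = A"
    and "U * mat_adjoint U = 1\<^sub>m n" and "mat_adjoint U * U = 1\<^sub>m n"
    and "dim_row U = n" and "dim_col U = n"
  using unitary_mat_cancel(2,3)[OF assms, of A "dim_col A"] assms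
  by (auto simp: unitary_mat_def)

abbreviation real_diag :: "nat \<Rightarrow> (nat \<Rightarrow> real) \<Rightarrow> complex mat" where
  "real_diag n d \<equiv> mat_diag n (\<lambda>i. complex_of_real (d i))"

lemma mat_diag_dims [simp]: "dim_row (mat_diag n d) = n" "dim_col (mat_diag n d) = n"
  by (simp_all add: mat_diag_def)

lemma mat_diag_entry: "i < n \<Longrightarrow> j < n \<Longrightarrow> mat_diag n d $$ (i, j) = (if i = j then d j else 0)"
  by (simp add: mat_diag_def)

lemma mat_adjoint_real_diag [simp]: "mat_adjoint (real_diag n d) = real_diag n d"
  by (rule eq_matI) (auto simp: mat_adjoint_index mat_diag_entry)

lemma diag_sandwich_index:
  fixes Y :: "complex mat"
  assumes Y: "Y \<in> carrier_mat n m" and ij: "i < n" "j < n"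
  shows "(Y * (mat_diag m d * mat_adjoint Y)) $$ (i, j)
    = (\<Sum>k<m. d k * (Y $$ (i, k) * cnj (Y $$ (j, k))))"
proof -
  have "mat_diag m d * mat_adjoint Y = mat m n (\<lambda>(k, j). d k * cnj (Y $$ (j, k)))"
    using Y by (subst mat_diag_mult_left[of _ m n]) (auto simp: mat_adjoint_index intro!: cong_mat)
  thus ?thesis
    using Y ij by (subst mat_mult_index[of _ n m _ n]) (auto intro!: sum.cong)
qed

section \<open>Unitary diagonalization\<close>

text \<open>
  Gram--Schmidt applied to a basis that begins with \<open>v\<close> leaves \<open>v\<close> in front; only the
  normalization of the columns remains.
\<close>
lemma unitary_mat_with_first_column:
  fixes v :: "complex vec"
  assumes v: "v \<in> carrier_vec n" and v0: "v \<noteq> 0\<^sub>v n"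
  shows "\<exists>U c. unitary_mat n U \<and> (\<forall>i<n. U $$ (i, 0) = c * v $ i)"
proof -
  interpret cof_vec_space n "TYPE(complex)" .
  define ws where "ws = gram_schmidt n (basis_completion v)"
  note b = basis_completion[OF v v0]
  have n: "n > 0" using v v0 by (cases n) auto
  have ws: "set ws \<subseteq> carrier_vec n" "corthogonal ws" "length ws = n"
    using gram_schmidt_result[OF b(2) b(4) b(5) ws_def] b(6) by auto
  obtain vs where bv: "basis_completion v = v # vs"
    using b(6,7) n by (cases "basis_completion v") auto
  have hd: "ws ! 0 = v"
    using gram_schmidt_hd[OF v, of vs] ws(3) n hd_conv_nth[of ws] unfolding ws_def bv by fastforce
  define N where "N j = sqrt (\<Sum>l<n. (cmod (ws ! j $ l))\<^sup>2)" for j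
  define U where "U = mat n n (\<lambda>(i, j). ws ! j $ i / complex_of_real (N j))"
  have U: "U \<in> carrier_mat n n" by (simp add: U_def)
  have ip: "ws ! i \<bullet>c ws ! j = (\<Sum>l<n. ws ! i $ l * cnj (ws ! j $ l))" if "i < n" "j < n" for i j
  proof -
    have "ws ! i \<in> carrier_vec n" "ws ! j \<in> carrier_vec n" using ws that by auto
    thus ?thesis by (auto simp: scalar_prod_def lessThan_atLeast0 intro!: sum.cong)
  qed
  have N2: "complex_of_real ((N j)\<^sup>2) = (\<Sum>l<n. ws ! j $ l * cnj (ws ! j $ l))" for j
    by (simp add: N_def real_sqrt_pow2 sum_nonneg complex_norm_square del: of_real_power)
  have N0: "N j \<noteq> 0" if "j < n" for j
    using corthogonalD[OF ws(2), of j j] that ws(3) ip[OF that that] N2[of j] by auto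
  have "mat_adjoint U * U = 1\<^sub>m n"
  proof (rule eq_matI)
    fix i j assume "i < dim_row (1\<^sub>m n)" "j < dim_col (1\<^sub>m n)"
    hence ij: "i < n" "j < n" by auto
    have "(mat_adjoint U * U) $$ (i, j) =
        (\<Sum>l<n. ws ! j $ l * cnj (ws ! i $ l)) / (complex_of_real (N i) * complex_of_real (N j))"
      using U ij by (subst mat_mult_index[of _ n n _ n])
        (auto simp: mat_adjoint_index sum_divide_distrib U_def mult.commute intro!: sum.cong)
    also have "\<dots> = (if i = j then 1 else 0)"
    proof (cases "i = j")
      case True
      thus ?thesis using N0[OF ij(2)] by (simp add: power2_eq_square N2[symmetric] del: of_real_power)
    next
      case False
      thus ?thesis using corthogonalD[OF ws(2), of j i] ij ws(3) ip[OF ij(2,1)] by auto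
    qed
    finally show "(mat_adjoint U * U) $$ (i, j) = 1\<^sub>m n $$ (i, j)" using ij by simp
  qed (use U in auto)
  hence "unitary_mat n U" by (rule unitary_mat_I[OF U])
  moreover have "\<forall>i<n. U $$ (i, 0) = (1 / complex_of_real (N 0)) * v $ i"
    using n by (simp add: U_def hd)
  ultimately show ?thesis by blast
qed

text \<open>
  The spectral theorem. Conjugation by a unitary matrix whose first column is an eigenvector
  clears the first column, and by Hermitian symmetry the first row, apart from the corner; the
  induction hypothesis diagonalizes the remaining block.
\<close>
lemma hermitian_unitary_diagonalization:
  fixes A :: "complex mat"
  assumes "A \<in> carrier_mat n n" "mat_adjoint A = A"
  shows "\<exists>U d. unitary_mat n U \<and> A = U * mat_diag n d * mat_adjoint U"
  using assms
proof (induction n arbitrary: A)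
  case 0
  thus ?case using unitary_mat_one[of 0] by (intro exI[of _ "1\<^sub>m 0"] exI[of _ "\<lambda>_. 0"]) auto
next
  case (Suc n A)
  note [simp del] = sum.lessThan_Suc
  let ?n = "Suc n"
  note A = Suc.prems(1) and herm = Suc.prems(2)
  obtain as where as: "char_poly A = (\<Prod>a\<leftarrow>as. [:- a, 1:])" "length as = ?n"
    using char_poly_factorized[OF A] by auto
  then obtain e where "poly (char_poly A) e = 0" by (cases as) auto
  then obtain v where "eigenvector A v e"
    using eigenvalue_root_char_poly[OF A] unfolding eigenvalue_def by auto
  hence v: "v \<in> carrier_vec ?n" "v \<noteq> 0\<^sub>v ?n" "A *\<^sub>v v = e \<cdot>\<^sub>v v"
    using A unfolding eigenvector_def by auto
  obtain U c where U: "unitary_mat ?n U" and U0: "\<And>i. i < ?n \<Longrightarrow> U $$ (i, 0) = c * v $ i"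
    using unitary_mat_with_first_column[OF v(1,2)] by blast
  note Uc [simp] = unitary_mat_carrier[OF U] and A [simp]
  have AU [simp]: "A * U \<in> carrier_mat ?n ?n" using A Uc by (rule mult_carrier_mat)
  define B where "B = mat_adjoint U * (A * U)"
  have B [simp]: "B \<in> carrier_mat ?n ?n"
    unfolding B_def by (auto intro!: mult_carrier_mat[of _ ?n ?n])
  have "mat_adjoint B = mat_adjoint (A * U) * U"
    unfolding B_def by (subst mat_adjoint_mult[of _ ?n ?n _ ?n]) auto
  also have "\<dots> = mat_adjoint U * A * U"
    by (subst mat_adjoint_mult[of _ ?n ?n _ ?n]) (auto simp: herm)
  also have "\<dots> = B"
    unfolding B_def by (rule assoc_mult_mat[of _ ?n ?n _ ?n _ ?n]) auto
  finally have hermB: "mat_adjoint B = B" .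
  have AU0: "(A * U) $$ (i, 0) = e * U $$ (i, 0)" if i: "i < ?n" for i
  proof -
    have "(A * U) $$ (i, 0) = c * (\<Sum>l<?n. A $$ (i, l) * v $ l)"
      using i U0 by (subst mat_mult_index[of _ ?n ?n _ ?n]) (auto simp: sum_distrib_left intro!: sum.cong)
    also have "(\<Sum>l<?n. A $$ (i, l) * v $ l) = (A *\<^sub>v v) $ i"
      using i v(1) carrier_matD[OF A] by (auto simp: scalar_prod_def atLeast0LessThan intro!: sum.cong)
    also have "\<dots> = e * v $ i" using v i by simp
    finally show ?thesis using U0[OF i] by simp
  qed
  have B0: "B $$ (i, 0) = (if i = 0 then e else 0)" if i: "i < ?n" for i
  proof -
    have "B $$ (i, 0) = (\<Sum>l<?n. mat_adjoint U $$ (i, l) * (e * U $$ (l, 0)))"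
      unfolding B_def using i AU0
      by (subst mat_mult_index[of _ ?n ?n _ ?n]) (auto intro!: sum.cong mult_carrier_mat[of _ ?n ?n]
          simp del: index_mult_mat(1))
    also have "\<dots> = e * (mat_adjoint U * U) $$ (i, 0)"
      using i by (subst mat_mult_index[of _ ?n ?n _ ?n]) (auto simp: sum_distrib_left intro!: sum.cong)
    also have "\<dots> = (if i = 0 then e else 0)"
      using U i by (simp add: unitary_mat_def)
    finally show ?thesis .
  qed
  have B0': "B $$ (0, j) = (if j = 0 then e else 0)" if j: "j < ?n" for j
  proof -
    have "B $$ (0, j) = cnj (B $$ (j, 0))"
      using mat_adjoint_index[of 0 B j] B j unfolding hermB by (metis carrier_matD zero_less_Suc)
    thus ?thesis using B0[OF j] B0[of 0] mat_adjoint_index[of 0 B 0] B hermB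
      by (auto split: if_splits)
  qed
  define C where "C = mat n n (\<lambda>(i, j). B $$ (Suc i, Suc j))"
  have C [simp]: "C \<in> carrier_mat n n" by (simp add: C_def)
  have Bblock: "B = four_block_mat (mat 1 1 (\<lambda>_. e)) (0\<^sub>m 1 n) (0\<^sub>m n 1) C"
    by (rule eq_matI) (use carrier_matD[OF B] in \<open>auto simp: C_def B0 B0' less_Suc_eq_0_disj\<close>)
  have "mat_adjoint C = C"
  proof (rule eq_matI)
    fix i j assume "i < dim_row C" "j < dim_col C"
    thus "mat_adjoint C $$ (i, j) = C $$ (i, j)"
      using mat_adjoint_index[of "Suc i" B "Suc j"] B unfolding hermB
      by (auto simp: mat_adjoint_index C_def)
  qed (auto simp: C_def)
  from Suc.IH[OF C this] obtain U3 d3 where U3: "unitary_mat n U3"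
    and CU: "C = U3 * mat_diag n d3 * mat_adjoint U3" by blast
  note U3c [simp] = unitary_mat_carrier[OF U3]
  define V where "V = four_block_mat (1\<^sub>m 1) (0\<^sub>m 1 n) (0\<^sub>m n 1) U3"
  define d where "d i = (case i of 0 \<Rightarrow> e | Suc i \<Rightarrow> d3 i)" for i
  have V [simp]: "V \<in> carrier_mat ?n ?n"
    unfolding V_def using four_block_carrier_mat[of "1\<^sub>m 1" 1 1 U3 n n] by simp
  have V': "mat_adjoint V = four_block_mat (1\<^sub>m 1) (0\<^sub>m 1 n) (0\<^sub>m n 1) (mat_adjoint U3)"
    by (rule eq_matI) (use carrier_matD[OF U3c] in \<open>auto simp: V_def mat_adjoint_index\<close>)
  have z: "0\<^sub>m 1 n * X = 0\<^sub>m 1 n" "X * 0\<^sub>m n 1 = 0\<^sub>m n 1"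
    if "X \<in> carrier_mat n n" for X :: "complex mat"
    using that by auto
  have "mat_adjoint V * V = 1\<^sub>m (1 + n)"
    unfolding V'
    by (subst V_def, subst mult_four_block_mat[of _ 1 1 _ n _ n _ _ 1 _ n])
      (use U3 in \<open>auto simp: unitary_mat_def z[OF U3c] z[OF mat_adjoint_carrier[OF U3c]] simp del: One_nat_def\<close>)
  hence VU: "unitary_mat ?n V" by (intro unitary_mat_I) auto
  have D: "mat_diag ?n d = four_block_mat (mat 1 1 (\<lambda>_. e)) (0\<^sub>m 1 n) (0\<^sub>m n 1) (mat_diag n d3)"
    by (rule eq_matI) (auto simp: d_def mat_diag_def less_Suc_eq_0_disj)
  have U3D: "U3 * mat_diag n d3 \<in> carrier_mat n n" by (rule mult_carrier_mat[OF U3c]) auto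
  have "V * mat_diag ?n d
      = four_block_mat (mat 1 1 (\<lambda>_. e)) (0\<^sub>m 1 n) (0\<^sub>m n 1) (U3 * mat_diag n d3)"
    unfolding D
    by (subst V_def, subst mult_four_block_mat[of _ 1 1 _ n _ n _ _ 1 _ n])
      (use U3D in \<open>auto simp: z[OF U3c] z[OF mat_diag_dim] simp del: One_nat_def\<close>)
  hence "V * mat_diag ?n d * mat_adjoint V = B"
    unfolding V' Bblock CU
    by (simp only:, subst mult_four_block_mat[of _ 1 1 _ n _ n _ _ 1 _ n])
      (use U3D in \<open>auto simp: z[OF U3D] z[OF mat_adjoint_carrier[OF U3c]] simp del: One_nat_def\<close>)
  hence BV: "B = V * mat_diag ?n d * mat_adjoint V" ..
  have "A = U * B * mat_adjoint U"
    unfolding B_def using unitary_mat_cancel(1)[OF U A] unitary_mat_cancel(2)[OF U, of "A * U" ?n]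
    by simp
  also have "\<dots> = (U * V) * mat_diag ?n d * mat_adjoint (U * V)"
    unfolding BV
    by (subst mat_adjoint_mult[of _ ?n ?n _ ?n]; (simp; fail)?)
      (simp add: assoc_mult_mat[of _ ?n ?n _ ?n _ ?n] mult_carrier_mat[of _ ?n ?n])
  finally show ?case using unitary_mat_mult[OF U VU] by blast
qed

section \<open>Gram matrices and their spectra\<close>

text \<open>
  The square of the Hilbert--Schmidt norm, that is, of the Schatten \<open>2\<close>-norm. It is the bridge
  between the two sides of the inequality: it dominates the square of every Schatten norm with \<open>p \<ge> 2\<close>,
  and it is a sum over entries.
\<close>
definition frob_sq :: "complex mat \<Rightarrow> real" where
  "frob_sq A = (\<Sum>i<dim_row A. \<Sum>j<dim_col A. (cmod (A $$ (i, j)))\<^sup>2)"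

lemma gram_index_diag:
  assumes V: "V \<in> carrier_mat n m"
  shows "i < n \<Longrightarrow> (V * mat_adjoint V) $$ (i, i) = complex_of_real (\<Sum>k<m. (cmod (V $$ (i, k)))\<^sup>2)"
    and "k < m \<Longrightarrow> (mat_adjoint V * V) $$ (k, k) = complex_of_real (\<Sum>i<n. (cmod (V $$ (i, k)))\<^sup>2)"
proof -
  have V': "mat_adjoint V \<in> carrier_mat m n" using V by simp
  show "i < n \<Longrightarrow> (V * mat_adjoint V) $$ (i, i) = complex_of_real (\<Sum>k<m. (cmod (V $$ (i, k)))\<^sup>2)"
    unfolding of_real_sum complex_norm_square using carrier_matD[OF V]
    by (subst mat_mult_index[OF V V']) (simp_all add: mat_adjoint_index)
  show "k < m \<Longrightarrow> (mat_adjoint V * V) $$ (k, k) = complex_of_real (\<Sum>i<n. (cmod (V $$ (i, k)))\<^sup>2)"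
    unfolding of_real_sum complex_norm_square using carrier_matD[OF V]
    by (subst mat_mult_index[OF V' V]) (simp_all add: mat_adjoint_index mult.commute)
qed

lemma frob_sq_eq_gram:
  assumes "V * mat_adjoint V = W * mat_adjoint W"
  shows "frob_sq V = frob_sq W"
proof -
  have d: "dim_row V = dim_row W" using arg_cong[OF assms, of dim_row] by simp
  have "(\<Sum>k<dim_col V. (cmod (V $$ (i, k)))\<^sup>2) = (\<Sum>k<dim_col W. (cmod (W $$ (i, k)))\<^sup>2)"
    if "i < dim_row V" for i
  proof -
    have "V \<in> carrier_mat (dim_row V) (dim_col V)" "W \<in> carrier_mat (dim_row V) (dim_col W)"
      using d by auto
    from this[THEN gram_index_diag(1), OF that] show ?thesis
      unfolding assms by (simp only: of_real_eq_iff)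
  qed
  thus ?thesis unfolding frob_sq_def d by (rule sum.cong[OF refl]) (simp add: d)
qed

lemma frob_sq_mult_unitary:
  assumes "unitary_mat m U" "dim_col V = m"
  shows "frob_sq (V * U) = frob_sq V"
  by (rule frob_sq_eq_gram)
    (use assms unitary_mat_rewrites[OF assms(1)] in \<open>simp add: mat_adjoint_times mat_mult_assoc\<close>)

lemma gram_diagonal_entries:
  assumes V: "V \<in> carrier_mat n m" and D: "mat_adjoint V * V = real_diag m d"
  shows "k < m \<Longrightarrow> d k = (\<Sum>i<n. (cmod (V $$ (i, k)))\<^sup>2)"
    and "(\<Sum>k<m. d k) = frob_sq V"
proof -
  have *: "d k = (\<Sum>i<n. (cmod (V $$ (i, k)))\<^sup>2)" if "k < m" for k
  proof -
    have "complex_of_real (d k) = complex_of_real (\<Sum>i<n. (cmod (V $$ (i, k)))\<^sup>2)"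
      unfolding gram_index_diag(2)[OF V that, symmetric] D by (simp add: mat_diag_entry that)
    thus ?thesis by (simp only: of_real_eq_iff)
  qed
  show "k < m \<Longrightarrow> d k = (\<Sum>i<n. (cmod (V $$ (i, k)))\<^sup>2)" by (rule *)
  have "(\<Sum>k<m. d k) = (\<Sum>k<m. \<Sum>i<n. (cmod (V $$ (i, k)))\<^sup>2)"
    by (intro sum.cong) (auto simp: *)
  also have "\<dots> = frob_sq V"
    using V by (subst sum.swap) (auto simp: frob_sq_def)
  finally show "(\<Sum>k<m. d k) = frob_sq V" .
qed

text \<open>
  A diagonalizing \<open>U\<close> turns \<open>V\<close> into a matrix \<open>V U\<close> with orthogonal columns, and the
  eigenvalues are the squared norms of these columns. This is why they are real and nonnegative.
\<close>
lemma gram_unitary_diagonalization: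
  assumes V: "V \<in> carrier_mat n m"
  obtains U d where "unitary_mat m U" "\<And>i. i < m \<Longrightarrow> d i \<ge> 0"
    "mat_adjoint V * V = U * (real_diag m d * mat_adjoint U)"
proof -
  have G: "mat_adjoint V * V \<in> carrier_mat m m" using V by auto
  have "mat_adjoint (mat_adjoint V * V) = mat_adjoint V * V"
    using V by (simp add: mat_adjoint_times)
  from hermitian_unitary_diagonalization[OF G this] obtain U c where U: "unitary_mat m U"
    and c: "mat_adjoint V * V = U * mat_diag m c * mat_adjoint U" by blast
  note [simp] = mat_mult_assoc unitary_mat_rewrites[OF U]
  define d where "d k = (\<Sum>i<n. (cmod ((V * U) $$ (i, k)))\<^sup>2)" for k
  have VU: "V * U \<in> carrier_mat n m" using V by auto
  have "mat_adjoint (V * U) * (V * U) = mat_adjoint U * (mat_adjoint V * V) * U"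
    using carrier_matD[OF V] by (simp add: mat_adjoint_times)
  also have "\<dots> = mat_diag m c" unfolding c by simp
  finally have "c k = complex_of_real (d k)" if "k < m" for k
    using gram_index_diag(2)[OF VU that] that by (simp add: d_def mat_diag_entry del: index_mult_mat(1))
  hence "mat_diag m c = real_diag m d" by (intro eq_matI) (auto simp: mat_diag_entry)
  thus ?thesis using that[OF U, of d] c by (simp add: d_def sum_nonneg)
qed

lemma rotated_gram:
  assumes V: "V \<in> carrier_mat n m" and U: "unitary_mat m U"
    and eq: "mat_adjoint V * V = U * (real_diag m d * mat_adjoint U)"
  shows "mat_adjoint (V * U) * (V * U) = real_diag m d"
proof -
  note [simp] = mat_mult_assoc unitary_mat_rewrites[OF U] carrier_matD[OF V]
  have "mat_adjoint (V * U) * (V * U) = mat_adjoint U * (mat_adjoint V * V) * U"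
    by (simp add: mat_adjoint_times)
  also have "\<dots> = real_diag m d" unfolding eq by simp
  finally show ?thesis .
qed

lemma sum_eigenvalues_gram:
  assumes V: "V \<in> carrier_mat n m" and U: "unitary_mat m U"
    and eq: "mat_adjoint V * V = U * (real_diag m d * mat_adjoint U)"
  shows "(\<Sum>k<m. d k) = frob_sq V"
proof -
  have "V * U \<in> carrier_mat n m" by (rule mult_carrier_mat[OF V]) (use U in simp)
  from gram_diagonal_entries(2)[OF this rotated_gram[OF assms]] show ?thesis
    using frob_sq_mult_unitary[OF U, of V] V by simp
qed

text \<open>
  The matrices \<open>V V\<^sup>*\<close> and \<open>V\<^sup>* V\<close> have the same nonzero eigenvalues. With eigenbases \<open>B\<close> and
  \<open>F\<close> the matrix \<open>C = B\<^sup>* V F\<close> satisfies \<open>C C\<^sup>* = diag d\<close> and \<open>C\<^sup>* C = diag g\<close>. Hence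
  \<open>diag d C = C diag g\<close>, so \<open>C\<close> links only equal eigenvalues, while its rows and columns have the
  squared norms \<open>d\<close> and \<open>g\<close>. Writing \<open>\<phi> x = x \<psi> x\<close>, both sums equal
  \<open>\<Sum>i k. \<psi> (d i) \<bar>C i k\<bar>\<^sup>2\<close>. Suitable choices of \<open>\<phi>\<close> give power sums of eigenvalues and also
  a comparison of ranks.
\<close>
lemma gram_spectra_agree:
  fixes \<phi> :: "real \<Rightarrow> real"
  assumes V: "V \<in> carrier_mat n m" and B: "unitary_mat n B" and F: "unitary_mat m F"
    and d: "V * mat_adjoint V = B * (real_diag n d * mat_adjoint B)"
    and g: "mat_adjoint V * V = F * (real_diag m g * mat_adjoint F)"
    and \<phi>: "\<phi> 0 = 0"
  shows "(\<Sum>i<n. \<phi> (d i)) = (\<Sum>k<m. \<phi> (g k))"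
proof -
  note [simp] = mat_mult_assoc unitary_mat_rewrites[OF B] unitary_mat_rewrites[OF F] carrier_matD[OF V]
  define C where "C = mat_adjoint B * (V * F)"
  have C: "C \<in> carrier_mat n m" unfolding C_def by auto
  have C': "mat_adjoint C \<in> carrier_mat m n" using C by auto
  have "C * mat_adjoint C = mat_adjoint B * (V * mat_adjoint V) * B"
    by (simp add: C_def mat_adjoint_times)
  hence dd: "C * mat_adjoint C = real_diag n d" unfolding d by simp
  have "mat_adjoint C * C = mat_adjoint F * (mat_adjoint V * V) * F"
    by (simp add: C_def mat_adjoint_times)
  hence gg: "mat_adjoint C * C = real_diag m g" unfolding g by simp
  have dCg: "real_diag n d * C = C * real_diag m g"
    unfolding dd[symmetric] gg[symmetric] using C by simp
  have comm: "complex_of_real (d i) * C $$ (i, k) = C $$ (i, k) * complex_of_real (g k)"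
    if "i < n" "k < m" for i k
    using arg_cong[OF dCg[unfolded mat_diag_mult_left[OF C] mat_diag_mult_right[OF C]],
        of "\<lambda>M. M $$ (i, k)"] that by simp
  \<comment> \<open>The convention \<open>y / 0 = 0\<close> and \<open>\<phi> 0 = 0\<close> make \<open>\<phi> x = \<psi> x * x\<close> hold at \<open>0\<close> too.\<close>
  define \<psi> where "\<psi> x = \<phi> x / x" for x
  have \<psi>: "\<phi> x = \<psi> x * x" for x using \<phi> by (simp add: \<psi>_def)
  have rows: "d i = (\<Sum>k<m. (cmod (C $$ (i, k)))\<^sup>2)" if "i < n" for i
    using gram_diagonal_entries(1)[OF C', of d i] dd that C by (simp add: mat_adjoint_index)
  have cols: "g k = (\<Sum>i<n. (cmod (C $$ (i, k)))\<^sup>2)" if "k < m" for k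
    using gram_diagonal_entries(1)[OF C gg that] .
  have "(\<Sum>i<n. \<phi> (d i)) = (\<Sum>i<n. \<Sum>k<m. \<psi> (d i) * (cmod (C $$ (i, k)))\<^sup>2)"
    by (intro sum.cong refl) (simp add: \<psi> rows[symmetric] flip: sum_distrib_left)
  also have "\<dots> = (\<Sum>i<n. \<Sum>k<m. \<psi> (g k) * (cmod (C $$ (i, k)))\<^sup>2)"
  proof (intro sum.cong refl)
    fix i k assume "i \<in> {..<n}" "k \<in> {..<m}"
    thus "\<psi> (d i) * (cmod (C $$ (i, k)))\<^sup>2 = \<psi> (g k) * (cmod (C $$ (i, k)))\<^sup>2"
      using comm[of i k] by (cases "C $$ (i, k) = 0") (auto simp: mult.commute)
  qed
  also have "\<dots> = (\<Sum>k<m. \<phi> (g k))"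
    by (subst sum.swap, intro sum.cong refl) (simp add: \<psi> cols[symmetric] flip: sum_distrib_left)
  finally show ?thesis .
qed

section \<open>Functional calculus and Schatten norms\<close>

text \<open>
  The intertwiner \<open>C = W\<^sup>* U\<close> satisfies \<open>C diag d = diag e C\<close>. An entry of \<open>C\<close> can be nonzero
  only where the two eigenvalues agree, so the relation survives any function of them.
\<close>
lemma functional_calculus_unique:
  assumes U: "unitary_mat n U" and W: "unitary_mat n W"
    and eq: "U * (real_diag n d * mat_adjoint U) = W * (real_diag n e * mat_adjoint W)"
  shows "U * (real_diag n (\<lambda>i. \<phi> (d i)) * mat_adjoint U) = W * (real_diag n (\<lambda>i. \<phi> (e i)) * mat_adjoint W)"
proof -
  note [simp] = mat_mult_assoc unitary_mat_rewrites[OF U] unitary_mat_rewrites[OF W]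
  define C where "C = mat_adjoint W * U"
  have C: "C \<in> carrier_mat n n" unfolding C_def by auto
  have "C * real_diag n d = mat_adjoint W * (U * (real_diag n d * mat_adjoint U)) * U"
    by (simp add: C_def)
  also have "\<dots> = real_diag n e * C"
    unfolding eq by (simp add: C_def)
  finally have comm: "C * real_diag n d = real_diag n e * C" .
  have entry: "C $$ (i, j) * complex_of_real (d j) = complex_of_real (e i) * C $$ (i, j)"
    if "i < n" "j < n" for i j
    using arg_cong[OF comm, of "\<lambda>M. M $$ (i, j)"] that
    by (simp add: mat_diag_mult_left[OF C] mat_diag_mult_right[OF C])
  have entry': "C $$ (i, j) * complex_of_real (\<phi> (d j)) = complex_of_real (\<phi> (e i)) * C $$ (i, j)"
    if "i < n" "j < n" for i j
    using entry[OF that] by (cases "C $$ (i, j) = 0") (auto simp: mult.commute)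
  have "C * real_diag n (\<lambda>i. \<phi> (d i)) = real_diag n (\<lambda>i. \<phi> (e i)) * C"
    unfolding mat_diag_mult_left[OF C] mat_diag_mult_right[OF C]
    by (rule eq_matI) (auto simp: entry')
  hence "W * (C * real_diag n (\<lambda>i. \<phi> (d i))) * mat_adjoint U
      = W * (real_diag n (\<lambda>i. \<phi> (e i)) * C) * mat_adjoint U" by simp
  thus ?thesis by (simp add: C_def)
qed

text \<open>
  Any diagonalization computes the real power, which makes the definite description usable.
\<close>
lemma mat_rpow_eq:
  assumes U: "unitary_mat n U" and d: "\<And>i. i < n \<Longrightarrow> d i \<ge> 0"
    and A: "A = U * (real_diag n d * mat_adjoint U)"
  shows "mat_rpow A t = U * (real_diag n (\<lambda>i. d i powr t) * mat_adjoint U)"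
proof -
  have n: "dim_row A = n" using unitary_mat_rewrites[OF U] by (simp add: A)
  note s = unitary_mat_rewrites(5,6)
  show ?thesis unfolding mat_rpow_def n
  proof (rule the_equality)
    show "\<exists>Ua da. unitary_mat n Ua \<and> (\<forall>i<n. 0 \<le> (da i :: real)) \<and>
        A = Ua * real_diag n da * mat_adjoint Ua \<and>
        U * (real_diag n (\<lambda>i. d i powr t) * mat_adjoint U)
          = Ua * real_diag n (\<lambda>i. da i powr t) * mat_adjoint Ua"
      by (rule exI[of _ U], rule exI[of _ d]) (use U d s[OF U] in \<open>auto simp: mat_mult_assoc A\<close>)
  next
    fix B assume "\<exists>Ua da. unitary_mat n Ua \<and> (\<forall>i<n. 0 \<le> (da i :: real)) \<and>
        A = Ua * real_diag n da * mat_adjoint Ua \<and>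
        B = Ua * real_diag n (\<lambda>i. da i powr t) * mat_adjoint Ua"
    then obtain W e where W: "unitary_mat n W" and "A = W * real_diag n e * mat_adjoint W"
      and B: "B = W * real_diag n (\<lambda>i. e i powr t) * mat_adjoint W" by blast
    hence "W * (real_diag n e * mat_adjoint W) = U * (real_diag n d * mat_adjoint U)"
      using A s[OF W] s[OF U] by (simp add: mat_mult_assoc)
    from functional_calculus_unique[OF W U this, of "\<lambda>x. x powr t"]
    show "B = U * (real_diag n (\<lambda>i. d i powr t) * mat_adjoint U)"
      using B s[OF W] s[OF U] by (simp add: mat_mult_assoc)
  qed
qed

lemma mat_trace_diagonalized:
  assumes U: "unitary_mat n U"
  shows "mat_trace (U * (real_diag n d * mat_adjoint U)) = complex_of_real (\<Sum>k<n. d k)"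
proof -
  have Uc: "U \<in> carrier_mat n n" using U by simp
  have "mat_trace (U * (real_diag n d * mat_adjoint U))
      = (\<Sum>i<n. \<Sum>k<n. complex_of_real (d k) * (U $$ (i, k) * cnj (U $$ (i, k))))"
    unfolding mat_trace_def using unitary_mat_rewrites[OF U]
    by (intro sum.cong) (auto simp del: index_mult_mat(1) simp: diag_sandwich_index[OF Uc])
  also have "\<dots> = (\<Sum>k<n. complex_of_real (d k) * (mat_adjoint U * U) $$ (k, k))"
    by (subst sum.swap) (intro sum.cong refl, simp del: index_mult_mat(1)
        add: gram_index_diag(2)[OF Uc] complex_norm_square sum_distrib_left del: of_real_power)
  also have "\<dots> = complex_of_real (\<Sum>k<n. d k)"
    by (simp add: unitary_mat_rewrites(4)[OF U])
  finally show ?thesis .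
qed

lemma mat_abs_eq:
  assumes U: "unitary_mat n U" and d: "\<And>i. i < n \<Longrightarrow> d i \<ge> 0"
    and A: "mat_adjoint A * A = U * (real_diag n d * mat_adjoint U)"
  shows "mat_abs A = U * (real_diag n (\<lambda>i. d i powr (1/2)) * mat_adjoint U)"
  unfolding mat_abs_def by (rule mat_rpow_eq[OF U d A])

lemma schatten_norm_eq:
  assumes U: "unitary_mat n U" and d: "\<And>i. i < n \<Longrightarrow> d i \<ge> 0"
    and A: "mat_adjoint A * A = U * (real_diag n d * mat_adjoint U)"
  shows "schatten_norm p A = (\<Sum>i<n. d i powr (p / 2)) powr (1 / p)"
proof -
  have "mat_rpow (mat_abs A) p = U * (real_diag n (\<lambda>i. (d i powr (1/2)) powr p) * mat_adjoint U)"
    using mat_abs_eq[OF U d A] by (intro mat_rpow_eq[OF U]) auto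
  thus ?thesis
    unfolding schatten_norm_def by (simp add: mat_trace_diagonalized[OF U] powr_powr del: of_real_sum)
qed

text \<open>
  The absolute value is recognized as soon as a positive semidefinite square root of \<open>A\<^sup>* A\<close> is
  exhibited; positivity enters through the factored form \<open>V V\<^sup>*\<close>.
\<close>
lemma abs_square_root_eq:
  assumes V: "V \<in> carrier_mat n m"
    and A: "mat_adjoint A * A = (V * mat_adjoint V) * (V * mat_adjoint V)"
  shows "mat_abs A = V * mat_adjoint V"
proof -
  obtain B d where B: "unitary_mat n B" and d: "\<And>i. i < n \<Longrightarrow> d i \<ge> (0::real)"
    and eq: "V * mat_adjoint V = B * (real_diag n d * mat_adjoint B)"
    using gram_unitary_diagonalization[OF mat_adjoint_carrier[OF V]] by auto
  note [simp] = mat_mult_assoc unitary_mat_rewrites[OF B] carrier_matD[OF V]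
  have dd: "real_diag n d * (real_diag n d * X) = real_diag n (\<lambda>i. (d i)\<^sup>2) * X" if "dim_row X = n" for X
    using that by (subst mat_mult_assoc[symmetric]) (auto simp: power2_eq_square)
  have "mat_adjoint A * A = B * (real_diag n (\<lambda>i. (d i)\<^sup>2) * mat_adjoint B)"
    unfolding A eq by (simp add: dd)
  hence "mat_abs A = B * (real_diag n (\<lambda>i. ((d i)\<^sup>2) powr (1/2)) * mat_adjoint B)"
    by (intro mat_abs_eq[OF B]) auto
  also have "real_diag n (\<lambda>i. ((d i)\<^sup>2) powr (1/2)) = real_diag n d"
    using d by (intro eq_matI) (auto simp: mat_diag_entry powr_half_sqrt)
  finally show ?thesis using eq by simp
qed

text \<open>
  The Schatten norm of the \<open>n \<times> n\<close> matrix \<open>V V\<^sup>*\<close> is read off from the \<open>m \<times> m\<close> Gram matrix. This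
  makes the bound depend on \<open>m\<close> only, not on the dimension \<open>n\<close>.
\<close>
lemma schatten_norm_gram:
  assumes V: "V \<in> carrier_mat n m" and F: "unitary_mat m F" and g: "\<And>k. k < m \<Longrightarrow> g k \<ge> 0"
    and eq: "mat_adjoint V * V = F * (real_diag m g * mat_adjoint F)"
  shows "schatten_norm p (V * mat_adjoint V) = (\<Sum>k<m. g k powr p) powr (1 / p)"
proof -
  obtain B d where B: "unitary_mat n B" and d: "\<And>i. i < n \<Longrightarrow> d i \<ge> (0::real)"
    and eqB: "V * mat_adjoint V = B * (real_diag n d * mat_adjoint B)"
    using gram_unitary_diagonalization[OF mat_adjoint_carrier[OF V]] by auto
  have herm: "mat_adjoint (V * mat_adjoint V) = V * mat_adjoint V"
    by (simp add: mat_adjoint_times)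
  have "mat_abs (V * mat_adjoint V) = B * (real_diag n d * mat_adjoint B)"
    using abs_square_root_eq[OF V, of "V * mat_adjoint V"] eqB herm by simp
  hence "mat_rpow (mat_abs (V * mat_adjoint V)) p = B * (real_diag n (\<lambda>i. d i powr p) * mat_adjoint B)"
    using d by (intro mat_rpow_eq[OF B])
  hence "schatten_norm p (V * mat_adjoint V) = (\<Sum>i<n. d i powr p) powr (1 / p)"
    unfolding schatten_norm_def by (simp add: mat_trace_diagonalized[OF B] del: of_real_sum)
  also have "(\<Sum>i<n. d i powr p) = (\<Sum>k<m. g k powr p)"
    by (rule gram_spectra_agree[OF V B F eqB eq]) simp
  finally show ?thesis .
qed

section \<open>The scalar extremal problem\<close>

lemma ln_ge_one_minus_inverse:
  fixes t :: real
  assumes "t > 0"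
  shows "1 - 1 / t \<le> ln t" and "ln t = 1 - 1 / t \<Longrightarrow> t = 1"
  using ln_le_minus_one[of "1 / t"] ln_eq_minus_one[of "1 / t"] assms by (auto simp: ln_div)

text \<open>
  Bernoulli's inequality for real exponents, with its equality case. From \<open>exp y \<ge> 1 + y\<close> one gets
  \<open>t powr (p - 1) \<ge> 1 + (p - 1) ln t\<close>; the bound \<open>ln t \<ge> 1 - 1 / t\<close>, an equality only at \<open>t = 1\<close>,
  then gives the claim after multiplication by \<open>t\<close>.
\<close>
lemma powr_Bernoulli:
  fixes t p :: real
  assumes p: "p > 1" and t: "t \<ge> 0"
  shows "1 + p * (t - 1) \<le> t powr p" and "t powr p = 1 + p * (t - 1) \<Longrightarrow> t = 1"
proof -
  have main: "1 + p * (t - 1) \<le> t powr p \<and> (t powr p = 1 + p * (t - 1) \<longrightarrow> t = 1)"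
  proof (cases "t = 0")
    case True
    thus ?thesis using p by simp
  next
    case False
    hence t: "t > 0" using t by simp
    have "1 + (p - 1) * ln t \<le> t powr (p - 1)"
      using exp_ge_add_one_self[of "(p - 1) * ln t"] t by (simp add: powr_def)
    hence "t * (1 + (p - 1) * ln t) \<le> t * t powr (p - 1)"
      using t by (intro mult_left_mono) auto
    also have "\<dots> = t powr p" using t by (simp add: powr_diff)
    finally have 1: "t + t * (p - 1) * ln t \<le> t powr p" by (simp add: algebra_simps)
    have tp: "t * (p - 1) > 0" using t p by simp
    have 2: "t * (p - 1) * (1 - 1 / t) = (p - 1) * (t - 1)" using t by (simp add: field_simps)
    have 3: "t * (p - 1) * (1 - 1 / t) \<le> t * (p - 1) * ln t"
      using ln_ge_one_minus_inverse(1)[OF t] tp by (intro mult_left_mono) auto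
    have 4: "t + (p - 1) * (t - 1) = 1 + p * (t - 1)" by (simp add: algebra_simps)
    have "t = 1" if "t powr p = 1 + p * (t - 1)"
    proof -
      have "t * (p - 1) * ln t = t * (p - 1) * (1 - 1 / t)"
        using 1 2 3 4 that by linarith
      hence "ln t = 1 - 1 / t" using tp by auto
      thus ?thesis by (rule ln_ge_one_minus_inverse(2)[OF t])
    qed
    thus ?thesis using 1 2 3 4 by linarith
  qed
  show "1 + p * (t - 1) \<le> t powr p" and "t powr p = 1 + p * (t - 1) \<Longrightarrow> t = 1"
    using main by auto
qed

lemma powr_tangent_line:
  fixes c y p :: real
  assumes p: "p > 1" and c: "c > 0" and y: "y \<ge> 0"
  shows "c powr p + p * c powr (p - 1) * (y - c) \<le> y powr p"
    and "y powr p = c powr p + p * c powr (p - 1) * (y - c) \<Longrightarrow> y = c"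
proof -
  have y': "y powr p = c powr p * (y / c) powr p"
    using c y by (simp add: powr_divide)
  have l: "c powr p + p * c powr (p - 1) * (y - c) = c powr p * (1 + p * (y / c - 1))"
    using c by (simp add: powr_diff field_simps)
  have cp: "c powr p > 0" using c by simp
  note B = powr_Bernoulli[OF p, of "y / c"]
  show "c powr p + p * c powr (p - 1) * (y - c) \<le> y powr p"
    unfolding l y' using B(1) cp c y by (intro mult_left_mono) auto
  show "y = c" if "y powr p = c powr p + p * c powr (p - 1) * (y - c)"
    using that B(2) cp c y unfolding l y' by auto
qed

text \<open>
  Existence is the intermediate value theorem on \<open>[1, m + 1]\<close>. For uniqueness, the equation reads
  \<open>x powr (p - 1) = 2 + (m - 1) / x\<close>, where the left side increases and the right side does not.
\<close>
lemma tz_x_root: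
  fixes p :: real and m :: nat
  assumes p: "p \<ge> 2" and m: "m \<ge> 2"
  shows tz_x_gt_1: "tz_x p m > 1"
    and tz_x_powr: "tz_x p m powr p = 2 * tz_x p m + real m - 1"
proof -
  let ?f = "\<lambda>x::real. x powr p - 2 * x - (real m - 1)"
  have "\<exists>x. 1 \<le> x \<and> x \<le> real m + 1 \<and> ?f x = 0"
  proof (rule IVT')
    show "?f 1 \<le> 0" using m by simp
    have "(real m + 1) powr 2 \<le> (real m + 1) powr p" using p by (intro powr_mono) auto
    moreover have "real m * 2 \<le> real m * real m" using m by (intro mult_left_mono) auto
    ultimately show "0 \<le> ?f (real m + 1)" by (simp add: power2_eq_square algebra_simps)
    show "continuous_on {1..real m + 1} ?f" by (intro continuous_intros) auto
  qed simp
  then obtain x where x: "x \<ge> 1" "?f x = 0" by auto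
  hence x1: "x > 1" using m by (cases "x = 1") auto
  have unique: "\<not> (1 < a \<and> a < b \<and> ?f a = 0 \<and> ?f b = 0)" for a b
  proof
    assume ab: "1 < a \<and> a < b \<and> ?f a = 0 \<and> ?f b = 0"
    have q: "z powr (p - 1) = 2 + (real m - 1) / z" if "?f z = 0" "z > 1" for z
      using that by (simp add: powr_diff field_simps)
    have "a powr (p - 1) < b powr (p - 1)" using ab p by (intro powr_less_mono2) auto
    moreover have "(real m - 1) / b \<le> (real m - 1) / a"
      using ab m by (intro divide_left_mono) auto
    ultimately show False using q[of a] q[of b] ab by auto
  qed
  have "tz_x p m = x"
    unfolding tz_x_def
  proof (rule the_equality)
    show "1 < x \<and> ?f x = 0" using x1 x by simp
    show "y = x" if "1 < y \<and> ?f y = 0" for y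
      using unique[of x y] unique[of y x] that x1 x by (meson linorder_neqE_linordered_idom)
  qed
  thus "tz_x p m > 1" "tz_x p m powr p = 2 * tz_x p m + real m - 1" using x x1 by auto
qed

text \<open>
  The scalar problem behind the constant: maximize \<open>g k0 * (\<Sum>k<m. g k)\<close> for a given \<open>\<Sum>k<m. g k powr p\<close>.
  Put \<open>c k = x\<close> at \<open>k0\<close> and \<open>c k = 1\<close> elsewhere. Adding up the tangent lines of \<open>t powr p\<close> at the points
  \<open>c k\<close> bounds the linear functional \<open>L = x powr (p - 1) * g k0 + (S - g k0)\<close>, where \<open>S\<close> is the sum of
  \<open>g\<close>. The equation for \<open>x\<close> says precisely that \<open>L\<close> is \<open>x + m - 1\<close> times \<open>a + b\<close> with
  \<open>a = g k0 / x\<close> and \<open>b = S / (x + m - 1)\<close>, so that the arithmetic--geometric mean inequality turns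
  the bound on \<open>L\<close> into one on the product. Equality in the tangent bounds forces \<open>g = c\<close>.
\<close>
lemma tz_scalar_bound_normalized:
  fixes g :: "nat \<Rightarrow> real"
  assumes p: "p \<ge> 2" and m: "m \<ge> 2" and g: "\<And>k. k < m \<Longrightarrow> g k \<ge> 0" and k0: "k0 < m"
    and norm: "(\<Sum>k<m. g k powr p) = tz_x p m powr p + real m - 1"
  shows "g k0 * (\<Sum>k<m. g k) \<le> tz_x p m * (tz_x p m + real m - 1)"
    and "g k0 * (\<Sum>k<m. g k) = tz_x p m * (tz_x p m + real m - 1)
      \<Longrightarrow> k < m \<Longrightarrow> g k = (if k = k0 then tz_x p m else 1)"
proof -
  define x where "x = tz_x p m"
  define c where "c k = (if k = k0 then x else 1)" for k
  define S where "S = (\<Sum>k<m. g k)"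
  have x1: "x > 1" and xp: "x powr p = 2 * x + real m - 1"
    using tz_x_root[OF p m] by (simp_all add: x_def)
  have c: "c k > 0" for k using x1 by (simp add: c_def)
  have split: "(\<Sum>k<m. h k) = h k0 + (\<Sum>k\<in>{..<m} - {k0}. h k)" for h :: "nat \<Rightarrow> real"
    using k0 by (subst sum.remove[of _ k0]) auto
  \<comment> \<open>The distance of \<open>t powr p\<close> from its tangent line at \<open>c k\<close>: nonnegative, and zero only for \<open>g k = c k\<close>.\<close>
  define \<delta> where "\<delta> k = g k powr p - (c k powr p + p * c k powr (p - 1) * (g k - c k))" for k
  have \<delta>0: "\<delta> k \<ge> 0" if "k < m" for k
    using powr_tangent_line(1)[OF _ c g[OF that], of p k] p by (simp add: \<delta>_def)
  have \<delta>sum: "(\<Sum>k<m. \<delta> k)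
      = p * ((x powr p + real m - 1) - (x powr (p - 1) * g k0 + (S - g k0)))"
  proof -
    have "(\<Sum>k<m. \<delta> k) = (\<Sum>k<m. g k powr p) - (\<Sum>k<m. c k powr p)
        - p * (\<Sum>k<m. c k powr (p - 1) * (g k - c k))"
      by (simp add: \<delta>_def sum_subtractf sum.distrib sum_distrib_left mult.assoc)
    also have "(\<Sum>k<m. c k powr p) = x powr p + real m - 1"
      using k0 by (simp add: split c_def of_nat_diff)
    also have "(\<Sum>k<m. c k powr (p - 1) * (g k - c k))
        = x powr (p - 1) * (g k0 - x) + (S - g k0 - (real m - 1))"
      unfolding S_def using k0 by (simp add: split c_def sum_subtractf of_nat_diff)
    also have "x powr (p - 1) * (g k0 - x) = x powr (p - 1) * g k0 - x powr p"
      using x1 by (simp add: powr_diff field_simps)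
    finally show ?thesis using norm by (simp add: x_def algebra_simps)
  qed
  have L: "x powr (p - 1) * g k0 + (S - g k0) \<le> 2 * (x + real m - 1)"
  proof -
    have "(\<Sum>k<m. \<delta> k) \<ge> 0" using \<delta>0 by (intro sum_nonneg) auto
    thus ?thesis using \<delta>sum p xp by (simp add: zero_le_mult_iff)
  qed
  define a where "a = g k0 / x"
  define b where "b = S / (x + real m - 1)"
  have xm: "x + real m - 1 > 0" using x1 m by simp
  have "x powr (p - 1) * g k0 + (S - g k0) = a * (2 * x + real m - 1 - x) + S"
  proof -
    have "x powr (p - 1) = (2 * x + real m - 1) / x" using x1 xp by (simp add: powr_diff)
    hence "x powr (p - 1) * g k0 = a * (2 * x + real m - 1)" by (simp add: a_def)
    moreover have "a * x = g k0" using x1 by (simp add: a_def)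
    ultimately show ?thesis by (simp add: algebra_simps)
  qed
  also have "\<dots> = (x + real m - 1) * (a + b)"
    using xm by (simp add: b_def field_simps)
  finally have ab: "x powr (p - 1) * g k0 + (S - g k0) = (x + real m - 1) * (a + b)" .
  have ab2: "a + b \<le> 2" using L xm mult_le_cancel_left_pos[OF xm, of "a + b" 2] unfolding ab by linarith
  have ab0: "a \<ge> 0" "b \<ge> 0" using g k0 x1 xm by (auto simp: a_def b_def S_def intro!: divide_nonneg_pos sum_nonneg)
  have prod: "g k0 * S = x * (x + real m - 1) * (a * b)"
    using x1 xm by (simp add: a_def b_def)
  have amgm: "4 * (a * b) = (a + b)\<^sup>2 - (a - b)\<^sup>2" by (simp add: power2_eq_square algebra_simps)
  have sq: "(a + b)\<^sup>2 \<le> 4" using power_mono[OF ab2, of 2] ab0 by simp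
  have "a * b \<le> 1" using amgm sq zero_le_power2[of "a - b"] by linarith
  thus "g k0 * (\<Sum>k<m. g k) \<le> tz_x p m * (tz_x p m + real m - 1)"
    using prod x1 xm mult_left_le[of "a * b" "x * (x + real m - 1)"] by (simp add: S_def x_def)
  assume eq: "g k0 * (\<Sum>k<m. g k) = tz_x p m * (tz_x p m + real m - 1)" and k: "k < m"
  have "a * b = 1" using eq prod x1 xm by (simp add: S_def x_def)
  hence "(a + b)\<^sup>2 = 4" using amgm sq zero_le_power2[of "a - b"] by linarith
  hence "(a + b)\<^sup>2 = 2\<^sup>2" by simp
  hence "a + b = 2" using ab0 power2_eq_imp_eq[of "a + b" 2] by simp
  hence "(\<Sum>k<m. \<delta> k) = 0" unfolding \<delta>sum ab using xp by simp
  hence "\<delta> k = 0" using \<delta>0 k by (subst (asm) sum_nonneg_eq_0_iff) auto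
  hence "g k = c k" using powr_tangent_line(2)[OF _ c g[OF k], of p k] p by (simp add: \<delta>_def)
  thus "g k = (if k = k0 then tz_x p m else 1)" by (simp add: c_def x_def)
qed

lemma tz_const_pos:
  assumes p: "p \<ge> 2" and m: "m \<ge> 2"
  shows "tz_const p m > 0"
proof -
  have x1: "tz_x p m > 1" by (rule tz_x_gt_1[OF p m])
  hence "tz_x p m * (tz_x p m + real m - 1) > 0" by (intro mult_pos_pos) auto
  moreover have "tz_x p m powr p + real m - 1 > 0" using x1 m by (simp add: add_pos_pos tz_x_powr[OF p m])
  ultimately show ?thesis unfolding tz_const_def by (intro divide_pos_pos) auto
qed

lemma powr_one_over_sq: "(a powr (1 / p))\<^sup>2 = a powr (2 / p)" for a p :: real
  unfolding power2_eq_square powr_add[symmetric] by simp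

lemma tz_scalar_bound:
  fixes g :: "nat \<Rightarrow> real"
  assumes p: "p \<ge> 2" and m: "m \<ge> 2" and g: "\<And>k. k < m \<Longrightarrow> g k \<ge> 0" and k0: "k0 < m"
    and pos: "(\<Sum>k<m. g k powr p) > 0"
  shows "g k0 * (\<Sum>k<m. g k) \<le> (tz_const p m * (\<Sum>k<m. g k powr p) powr (1 / p))\<^sup>2"
    and "g k0 * (\<Sum>k<m. g k) = (tz_const p m * (\<Sum>k<m. g k powr p) powr (1 / p))\<^sup>2
      \<Longrightarrow> \<exists>\<nu>>0. \<forall>k<m. g k = (if k = k0 then tz_x p m * \<nu> else \<nu>)"
proof -
  define x where "x = tz_x p m"
  define N where "N = (\<Sum>k<m. g k powr p)"
  define M where "M = x powr p + real m - 1"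
  define t where "t = (M / N) powr (1 / p)"
  have x1: "x > 1" and xp: "x powr p = 2 * x + real m - 1"
    using tz_x_root[OF p m] by (simp_all add: x_def)
  have M: "M > 0" using x1 m by (simp add: M_def xp)
  have N: "N > 0" using pos by (simp add: N_def)
  have t: "t > 0" using M N by (simp add: t_def)
  have tp: "t powr p = M / N" using M N p by (simp add: t_def powr_powr)
  define h where "h k = t * g k" for k
  have h: "h k \<ge> 0" if "k < m" for k using g[OF that] t by (simp add: h_def)
  have "(\<Sum>k<m. h k powr p) = t powr p * N"
    unfolding N_def sum_distrib_left using g t by (intro sum.cong) (auto simp: h_def powr_mult)
  hence hN: "(\<Sum>k<m. h k powr p) = tz_x p m powr p + real m - 1"
    using tp N by (simp add: M_def x_def)
  note B = tz_scalar_bound_normalized[OF p m h k0 hN, folded x_def]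
  have hh: "h k0 * (\<Sum>k<m. h k) = t\<^sup>2 * (g k0 * (\<Sum>k<m. g k))"
    by (simp add: h_def power2_eq_square flip: sum_distrib_left)
  have xx: "x * (x + real m - 1) > 0" using x1 by (intro mult_pos_pos) auto
  have rhs: "t\<^sup>2 * (tz_const p m * N powr (1 / p))\<^sup>2 = x * (x + real m - 1)"
  proof -
    have "(tz_const p m)\<^sup>2 = x * (x + real m - 1) / M powr (2 / p)"
      using xx unfolding tz_const_def x_def[symmetric] M_def[symmetric]
      by (simp add: power_divide powr_one_over_sq)
    moreover have "t\<^sup>2 = M powr (2 / p) / N powr (2 / p)"
      using M N by (simp add: t_def powr_divide power_divide powr_one_over_sq)
    ultimately show ?thesis using M N by (simp add: power_mult_distrib powr_one_over_sq)
  qed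
  have "t\<^sup>2 * (g k0 * (\<Sum>k<m. g k)) \<le> t\<^sup>2 * (tz_const p m * N powr (1 / p))\<^sup>2"
    using B(1) unfolding hh rhs .
  thus "g k0 * (\<Sum>k<m. g k) \<le> (tz_const p m * (\<Sum>k<m. g k powr p) powr (1 / p))\<^sup>2"
    using t by (simp add: N_def)
  assume "g k0 * (\<Sum>k<m. g k) = (tz_const p m * (\<Sum>k<m. g k powr p) powr (1 / p))\<^sup>2"
  hence hx: "h k0 * (\<Sum>k<m. h k) = x * (x + real m - 1)"
    unfolding hh rhs[symmetric] by (simp add: N_def)
  have "h k = (if k = k0 then x else 1)" if "k < m" for k
    by (rule B(2)[OF _ hx that])
  hence "\<forall>k<m. g k = (if k = k0 then x * (1 / t) else 1 / t)"
    using t by (auto simp: h_def field_simps)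
  thus "\<exists>\<nu>>0. \<forall>k<m. g k = (if k = k0 then tz_x p m * \<nu> else \<nu>)"
    using t by (intro exI[of _ "1 / t"]) (auto simp: x_def)
qed

text \<open>
  With \<open>D\<close> the sum of all \<open>d i\<close>, each term is at most \<open>d i * D powr (q - 1)\<close>.
\<close>
lemma sum_powr_le_powr_sum:
  fixes d :: "nat \<Rightarrow> real"
  assumes q: "q \<ge> 1" and d: "\<And>i. i < n \<Longrightarrow> d i \<ge> 0"
  shows "(\<Sum>i<n. d i powr q) \<le> (\<Sum>i<n. d i) powr q"
proof -
  define D where "D = (\<Sum>i<n. d i)"
  have le: "d i \<le> D" if "i < n" for i
    unfolding D_def using d that by (intro member_le_sum) auto
  have D0: "D \<ge> 0" unfolding D_def using d by (intro sum_nonneg) auto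
  have split: "y powr q = y * y powr (q - 1)" if "y \<ge> 0" for y :: real
    using that by (cases "y = 0") (auto simp: powr_diff)
  have "(\<Sum>i<n. d i powr q) \<le> (\<Sum>i<n. d i * D powr (q - 1))"
    using d le q by (intro sum_mono) (auto simp: split intro!: mult_left_mono powr_mono2)
  also have "\<dots> = D powr q" using split[OF D0] by (simp add: D_def sum_distrib_right)
  finally show ?thesis by (simp add: D_def)
qed

section \<open>The inequality for factored matrices and its equality case\<close>

lemma frob_sq_weighted:
  assumes Y: "Y \<in> carrier_mat n m"
    and eq: "A * mat_adjoint A = Y * (real_diag m g * mat_adjoint Y)"
  shows "frob_sq A = (\<Sum>k<m. g k * (\<Sum>i<n. (cmod (Y $$ (i, k)))\<^sup>2))"
proof -
  have n: "dim_row A = n" using arg_cong[OF eq, of dim_row] Y by simp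
  have "(\<Sum>j<dim_col A. (cmod (A $$ (i, j)))\<^sup>2) = (\<Sum>k<m. g k * (cmod (Y $$ (i, k)))\<^sup>2)"
    if i: "i < n" for i
  proof -
    have "A \<in> carrier_mat n (dim_col A)" using n by auto
    from gram_index_diag(1)[OF this i]
    have "complex_of_real (\<Sum>j<dim_col A. (cmod (A $$ (i, j)))\<^sup>2)
        = (\<Sum>k<m. complex_of_real (g k) * (Y $$ (i, k) * cnj (Y $$ (i, k))))"
      unfolding eq diag_sandwich_index[OF Y i i] by (rule sym)
    also have "\<dots> = complex_of_real (\<Sum>k<m. g k * (cmod (Y $$ (i, k)))\<^sup>2)"
      unfolding of_real_sum of_real_mult complex_norm_square ..
    finally show ?thesis by (simp only: of_real_eq_iff)
  qed
  hence "frob_sq A = (\<Sum>i<n. \<Sum>k<m. g k * (cmod (Y $$ (i, k)))\<^sup>2)"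
    unfolding frob_sq_def n by (rule sum.cong[OF refl]) simp
  also have "\<dots> = (\<Sum>k<m. g k * (\<Sum>i<n. (cmod (Y $$ (i, k)))\<^sup>2))"
    by (subst sum.swap) (simp add: sum_distrib_left)
  finally show ?thesis .
qed

lemma frob_sq_columns:
  "A \<in> carrier_mat n m \<Longrightarrow> frob_sq A = (\<Sum>k<m. \<Sum>i<n. (cmod (A $$ (i, k)))\<^sup>2)"
  unfolding frob_sq_def by (subst sum.swap) auto

text \<open>
  The Schatten norms decrease in \<open>p\<close>; here the comparison is with \<open>p = 2\<close>.
\<close>
lemma schatten_norm_sq_le_frob_sq:
  assumes A: "A \<in> carrier_mat n n" and p: "p \<ge> 2"
  shows "(schatten_norm p A)\<^sup>2 \<le> frob_sq A"
proof -
  obtain U d where U: "unitary_mat n U" and d: "\<And>i. i < n \<Longrightarrow> d i \<ge> (0::real)"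
    and eq: "mat_adjoint A * A = U * (real_diag n d * mat_adjoint U)"
    using gram_unitary_diagonalization[OF A] by blast
  have D: "(\<Sum>i<n. d i) = frob_sq A" by (rule sum_eigenvalues_gram[OF A U eq])
  have D0: "frob_sq A \<ge> 0" unfolding frob_sq_def by (intro sum_nonneg) auto
  have "(\<Sum>i<n. d i powr (p / 2)) \<le> frob_sq A powr (p / 2)"
    unfolding D[symmetric] by (rule sum_powr_le_powr_sum) (use p d in auto)
  hence "(\<Sum>i<n. d i powr (p / 2)) powr (2 / p) \<le> (frob_sq A powr (p / 2)) powr (2 / p)"
    using p by (intro powr_mono2) (auto intro!: sum_nonneg)
  also have "\<dots> = frob_sq A" using p D0 by (simp add: powr_powr)
  also have "(\<Sum>i<n. d i powr (p / 2)) powr (2 / p) = (schatten_norm p A)\<^sup>2"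
    using schatten_norm_eq[OF U d eq] by (simp add: powr_one_over_sq)
  finally show ?thesis .
qed

lemma schatten_norm_gram_pos:
  assumes V: "V \<in> carrier_mat n m" and pos: "frob_sq V > 0"
  shows "schatten_norm p (V * mat_adjoint V) > 0"
proof -
  obtain F g where F: "unitary_mat m F" and g: "\<And>k. k < m \<Longrightarrow> g k \<ge> (0::real)"
    and eq: "mat_adjoint V * V = F * (real_diag m g * mat_adjoint F)"
    using gram_unitary_diagonalization[OF V] by blast
  have "(\<Sum>k<m. g k) > 0" using sum_eigenvalues_gram[OF V F eq] pos by simp
  then obtain k where k: "k < m" "g k > 0"
    by (metis lessThan_iff not_less sum_nonpos)
  have "(\<Sum>k<m. g k powr p) > 0"
    by (rule sum_pos2[of _ k]) (use k in auto)
  thus ?thesis using schatten_norm_gram[OF V F g eq] by simp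
qed

text \<open>
  The heart of the proof. Let \<open>G = V\<^sup>* V\<close> have eigenvalues \<open>g\<close>, the largest being \<open>g k0\<close>, and let
  \<open>T\<close> be its trace. In an eigenbasis \<open>F\<close> of \<open>G\<close>, with \<open>Y = X F\<close>, the squared Hilbert--Schmidt norm of
  \<open>X V\<^sup>*\<close> is the weighted sum \<open>\<Sum>k. g k * \<parallel>Y k\<parallel>\<^sup>2\<close> over the columns of
  \<open>Y\<close>; it is at most \<open>g k0 * T\<close> because \<open>X\<close> and \<open>V\<close> have the same Hilbert--Schmidt norm. The scalar bound finishes the estimate.

  If equality holds, the scalar problem makes \<open>g k0 = x \<nu>\<close> a simple eigenvalue and all other
  eigenvalues equal to \<open>\<nu> > 0\<close>. Then only the column \<open>k0\<close> of \<open>Y\<close> survives, so \<open>X\<close> has rank one, and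
  \<open>G\<close> is a rank-one perturbation of \<open>\<nu>\<close> times the identity along the same vector \<open>f\<close>. As \<open>G\<close> has full
  rank, \<open>V\<close> has rank \<open>m\<close>, whence \<open>m \<le> n\<close>.
\<close>
lemma factored_bound:
  assumes p: "p \<ge> 2" and m: "m \<ge> 2"
    and X: "X \<in> carrier_mat n m" and V: "V \<in> carrier_mat n m"
    and cols: "\<And>k. k < m \<Longrightarrow> (\<Sum>i<n. (cmod (X $$ (i, k)))\<^sup>2) = (\<Sum>i<n. (cmod (V $$ (i, k)))\<^sup>2)"
    and pos: "frob_sq V > 0"
  shows "schatten_norm p (X * mat_adjoint V) \<le> tz_const p m * schatten_norm p (V * mat_adjoint V)"
    and "schatten_norm p (X * mat_adjoint V) = tz_const p m * schatten_norm p (V * mat_adjoint V) \<Longrightarrow>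
      m \<le> n \<and> (\<exists>\<nu> y f. \<nu> > 0 \<and> (\<Sum>k<m. (cmod (f k))\<^sup>2) = 1 \<and>
        (\<forall>i<n. \<forall>k<m. X $$ (i, k) = y i * cnj (f k)) \<and>
        (\<forall>j<m. \<forall>k<m. (mat_adjoint V * V) $$ (j, k) =
          complex_of_real \<nu> * (if j = k then 1 else 0)
          + complex_of_real ((tz_x p m - 1) * \<nu>) * (f j * cnj (f k))))"
proof -
  obtain F g where F: "unitary_mat m F" and g: "\<And>k. k < m \<Longrightarrow> g k \<ge> (0::real)"
    and eq: "mat_adjoint V * V = F * (real_diag m g * mat_adjoint F)"
    using gram_unitary_diagonalization[OF V] by blast
  note [simp] = mat_mult_assoc unitary_mat_rewrites[OF F] carrier_matD[OF X] carrier_matD[OF V]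
  have Fc: "F \<in> carrier_mat m m" using F by simp
  define A where "A = X * mat_adjoint V"
  define Y where "Y = X * F"
  define col where "col k = (\<Sum>i<n. (cmod (Y $$ (i, k)))\<^sup>2)" for k
  define N where "N = (\<Sum>k<m. g k powr p)"
  define T where "T = (\<Sum>k<m. g k)"
  have A: "A \<in> carrier_mat n n" by (auto simp: A_def)
  have Y: "Y \<in> carrier_mat n m" by (auto simp: Y_def)
  have XY: "X = Y * mat_adjoint F" by (simp add: Y_def)
  have T: "T = frob_sq V" unfolding T_def by (rule sum_eigenvalues_gram[OF V F eq])
  have "frob_sq X = frob_sq V"
    unfolding frob_sq_columns[OF X] frob_sq_columns[OF V] by (rule sum.cong[OF refl]) (simp add: cols)
  hence "frob_sq Y = T" using frob_sq_mult_unitary[OF F, of X] by (simp add: Y_def T)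
  hence colT: "(\<Sum>k<m. col k) = T" unfolding frob_sq_columns[OF Y] col_def .
  have col0: "col k \<ge> 0" for k unfolding col_def by (intro sum_nonneg) auto
  have "A * mat_adjoint A = X * (mat_adjoint V * V) * mat_adjoint X"
    by (simp add: A_def mat_adjoint_times)
  also have "\<dots> = Y * (real_diag m g * mat_adjoint Y)"
    unfolding eq by (simp add: Y_def mat_adjoint_times)
  finally have frobA: "frob_sq A = (\<Sum>k<m. g k * col k)"
    unfolding col_def by (rule frob_sq_weighted[OF Y])
  have "Max (g ` {..<m}) \<in> g ` {..<m}" using m by (intro Max_in) (auto simp: lessThan_empty_iff)
  then obtain k0 where k0: "k0 < m" and "g k0 = Max (g ` {..<m})" by auto
  hence max: "g k \<le> g k0" if "k < m" for k using that by simp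
  have defect: "g k0 * T - frob_sq A = (\<Sum>k<m. (g k0 - g k) * col k)"
    unfolding frobA colT[symmetric] by (simp add: sum_distrib_left sum_subtractf left_diff_distrib)
  have frob_le: "frob_sq A \<le> g k0 * T"
    using defect sum_nonneg[of "{..<m}" "\<lambda>k. (g k0 - g k) * col k"] max col0 by fastforce
  have S: "schatten_norm p (V * mat_adjoint V) = N powr (1 / p)"
    unfolding N_def by (rule schatten_norm_gram[OF V F g eq])
  have "N \<noteq> 0" using schatten_norm_gram_pos[OF V pos, of p] unfolding S by auto
  moreover have "N \<ge> 0" unfolding N_def by (intro sum_nonneg) auto
  ultimately have N: "N > 0" by simp
  note B = tz_scalar_bound[OF p m g k0 N[unfolded N_def], folded N_def T_def]
  have C: "tz_const p m > 0" by (rule tz_const_pos[OF p m])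
  have schatten_le: "(schatten_norm p A)\<^sup>2 \<le> frob_sq A" by (rule schatten_norm_sq_le_frob_sq[OF A p])
  have bound: "g k0 * T \<le> (tz_const p m * N powr (1 / p))\<^sup>2" using B(1) by blast
  show "schatten_norm p (X * mat_adjoint V) \<le> tz_const p m * schatten_norm p (V * mat_adjoint V)"
    unfolding S A_def[symmetric]
    by (rule power2_le_imp_le) (use schatten_le frob_le bound C in auto)
  assume "schatten_norm p (X * mat_adjoint V) = tz_const p m * schatten_norm p (V * mat_adjoint V)"
  hence e: "(schatten_norm p A)\<^sup>2 = (tz_const p m * N powr (1 / p))\<^sup>2" unfolding S A_def[symmetric] by simp
  hence "g k0 * T = (tz_const p m * N powr (1 / p))\<^sup>2"
    using schatten_le frob_le bound by linarith
  then obtain \<nu> where \<nu>: "\<nu> > 0" and gk: "\<And>k. k < m \<Longrightarrow> g k = (if k = k0 then tz_x p m * \<nu> else \<nu>)"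
    using B(2) by blast
  have x1: "tz_x p m > 1" by (rule tz_x_gt_1[OF p m])
  have "(\<Sum>k<m. (g k0 - g k) * col k) = 0"
    using e schatten_le frob_le bound defect by linarith
  hence z: "(g k0 - g k) * col k = 0" if "k < m" for k
    using that max col0 by (subst (asm) sum_nonneg_eq_0_iff) auto
  have Yz: "Y $$ (i, k) = 0" if "i < n" "k < m" "k \<noteq> k0" for i k
  proof -
    have "g k0 - g k = (tz_x p m - 1) * \<nu>"
      using gk[OF that(2)] gk[OF k0] that(3) by (simp add: algebra_simps)
    hence "col k = 0" using z[OF that(2)] x1 \<nu> by auto
    thus ?thesis unfolding col_def using that(1) by (subst (asm) sum_nonneg_eq_0_iff) auto
  qed
  define f where "f j = F $$ (j, k0)" for j
  define y where "y i = Y $$ (i, k0)" for i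
  have f1: "(\<Sum>k<m. (cmod (f k))\<^sup>2) = 1"
  proof -
    have "complex_of_real (\<Sum>k<m. (cmod (f k))\<^sup>2) = 1"
      unfolding f_def gram_index_diag(2)[OF Fc k0, symmetric] using k0 by simp
    thus ?thesis by (simp only: of_real_eq_1_iff)
  qed
  have Xf: "X $$ (i, k) = y i * cnj (f k)" if "i < n" "k < m" for i k
  proof -
    have "X $$ (i, k) = (\<Sum>l<m. Y $$ (i, l) * mat_adjoint F $$ (l, k))"
      by (subst XY, rule mat_mult_index[OF Y mat_adjoint_carrier[OF Fc] that])
    also have "\<dots> = (\<Sum>l<m. if l = k0 then y i * cnj (f k) else 0)"
      using that Yz by (intro sum.cong) (auto simp: mat_adjoint_index y_def f_def)
    finally show ?thesis using k0 by simp
  qed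
  have Gf: "(mat_adjoint V * V) $$ (j, k) = complex_of_real \<nu> * (if j = k then 1 else 0)
      + complex_of_real ((tz_x p m - 1) * \<nu>) * (f j * cnj (f k))" if "j < m" "k < m" for j k
  proof -
    have "(\<Sum>l<m. F $$ (j, l) * cnj (F $$ (k, l))) = (F * mat_adjoint F) $$ (j, k)"
      using that by (subst mat_mult_index[OF Fc mat_adjoint_carrier[OF Fc]]) (auto simp: mat_adjoint_index)
    hence one: "(\<Sum>l<m. F $$ (j, l) * cnj (F $$ (k, l))) = (if j = k then 1 else 0)"
      using that by simp
    have "(mat_adjoint V * V) $$ (j, k) = (\<Sum>l<m. complex_of_real (g l) * (F $$ (j, l) * cnj (F $$ (k, l))))"
      unfolding eq by (rule diag_sandwich_index[OF Fc that])
    also have "\<dots> = (\<Sum>l<m. complex_of_real \<nu> * (F $$ (j, l) * cnj (F $$ (k, l)))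
        + (if l = k0 then complex_of_real ((tz_x p m - 1) * \<nu>) * (f j * cnj (f k)) else 0))"
      by (intro sum.cong) (auto simp: gk f_def algebra_simps)
    also have "\<dots> = complex_of_real \<nu> * (\<Sum>l<m. F $$ (j, l) * cnj (F $$ (k, l)))
        + complex_of_real ((tz_x p m - 1) * \<nu>) * (f j * cnj (f k))"
      using k0 by (simp add: sum.distrib sum_distrib_left)
    finally show ?thesis unfolding one .
  qed
  have "m \<le> n"
  proof -
    obtain U d where U: "unitary_mat n U" and "\<And>i. i < n \<Longrightarrow> d i \<ge> (0::real)"
      and Ud: "V * mat_adjoint V = U * (real_diag n d * mat_adjoint U)"
      using gram_unitary_diagonalization[OF mat_adjoint_carrier[OF V]] by auto
    \<comment> \<open>Counting the nonzero eigenvalues of both Gram matrices compares their ranks.\<close>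
    define ind :: "real \<Rightarrow> real" where "ind t = (if t = 0 then 0 else 1)" for t
    have "ind (g k) = 1" if "k < m" for k using \<nu> x1 by (simp add: gk[OF that] ind_def)
    hence "(\<Sum>k<m. ind (g k)) = real m" by simp
    moreover have "(\<Sum>i<n. ind (d i)) \<le> real n"
      using sum_bounded_above[of "{..<n}" "\<lambda>i. ind (d i)" 1] by (simp add: ind_def)
    ultimately show ?thesis
      using gram_spectra_agree[OF V U F Ud eq, of ind] by (simp add: ind_def)
  qed
  with \<nu> f1 Xf Gf show "m \<le> n \<and> (\<exists>\<nu> y f. \<nu> > 0 \<and> (\<Sum>k<m. (cmod (f k))\<^sup>2) = 1 \<and>
        (\<forall>i<n. \<forall>k<m. X $$ (i, k) = y i * cnj (f k)) \<and>
        (\<forall>j<m. \<forall>k<m. (mat_adjoint V * V) $$ (j, k) =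
          complex_of_real \<nu> * (if j = k then 1 else 0)
          + complex_of_real ((tz_x p m - 1) * \<nu>) * (f j * cnj (f k))))" by blast
qed

section \<open>Matrices of rank at most one\<close>

text \<open>
  A nonzero minor would make the two columns involved linearly independent.
\<close>
lemma rank_le_1_imp_minor_zero:
  fixes A :: "complex mat"
  assumes A: "A \<in> carrier_mat n n" and rank: "vec_space.rank n A \<le> 1"
    and ij: "i < n" "i' < n" "j < n" "j' < n"
  shows "A $$ (i, j) * A $$ (i', j') = A $$ (i, j') * A $$ (i', j)"
proof (rule ccontr)
  assume ne: "\<not> ?thesis"
  interpret vec_space "TYPE(complex)" n .
  let ?a = "col A j" and ?b = "col A j'"
  have ab: "?a \<in> carrier_vec n" "?b \<in> carrier_vec n" using A ij by auto
  have dist: "?a \<noteq> ?b"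
  proof
    assume "?a = ?b"
    hence "A $$ (l, j) = A $$ (l, j')" if "l < n" for l
      using A ij that by (metis carrier_matD index_col)
    thus False using ne ij by (simp add: mult.commute)
  qed
  have "lin_indpt {?a, ?b}"
  proof (rule finite_lin_indpt2)
    show "finite {?a, ?b}" "{?a, ?b} \<subseteq> carrier_vec n" using ab by auto
    fix c assume z: "lincomb c {?a, ?b} = 0\<^sub>v n"
    have e: "c ?a * A $$ (l, j) + c ?b * A $$ (l, j') = 0" if "l < n" for l
    proof -
      have "lincomb c {?a, ?b} $ l = (\<Sum>v\<in>{?a, ?b}. c v * v $ l)"
        using ab that by (intro lincomb_index) auto
      thus ?thesis using dist z that A ij by simp
    qed
    note e1 = e[OF ij(1)] and e2 = e[OF ij(2)]
    have "c ?a * (A $$ (i, j) * A $$ (i', j') - A $$ (i, j') * A $$ (i', j)) =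
        (c ?a * A $$ (i, j) + c ?b * A $$ (i, j')) * A $$ (i', j')
        - (c ?a * A $$ (i', j) + c ?b * A $$ (i', j')) * A $$ (i, j')"
      by (simp add: algebra_simps)
    hence a0: "c ?a = 0" using ne e1 e2 by simp
    have "c ?b * (A $$ (i, j) * A $$ (i', j') - A $$ (i, j') * A $$ (i', j)) =
        (c ?a * A $$ (i', j) + c ?b * A $$ (i', j')) * A $$ (i, j)
        - (c ?a * A $$ (i, j) + c ?b * A $$ (i, j')) * A $$ (i', j)"
      by (simp add: algebra_simps)
    hence "c ?b = 0" using ne e1 e2 by simp
    with a0 show "\<forall>v\<in>{?a, ?b}. c v = 0" by simp
  qed
  hence "card {?a, ?b} \<le> rank A"
    using A ij by (intro rank_ge_card_indpt[OF A]) (auto simp: cols_def)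
  thus False using dist rank by simp
qed

text \<open>
  The vanishing of all minors through one nonzero entry gives a factorization into a column and a
  row. Balancing the norms of the two factors makes the absolute value of \<open>A\<close> equal to \<open>w w\<^sup>*\<close>.
\<close>
lemma rank_le_1_balanced_factorization:
  fixes A :: "complex mat"
  assumes A: "A \<in> carrier_mat n n" and rank: "vec_space.rank n A \<le> 1"
  shows "\<exists>x w. (\<forall>i<n. \<forall>j<n. A $$ (i, j) = x i * cnj (w j)) \<and>
     (\<Sum>i<n. (cmod (x i))\<^sup>2) = (\<Sum>i<n. (cmod (w i))\<^sup>2)"
proof (cases "\<exists>i<n. \<exists>j<n. A $$ (i, j) \<noteq> 0")
  case False
  thus ?thesis by (intro exI[of _ "\<lambda>_. 0"]) auto
next
  case True
  then obtain a b where ab: "a < n" "b < n" "A $$ (a, b) \<noteq> 0" by blast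
  define x where "x i = A $$ (i, b)" for i
  define w where "w j = cnj (A $$ (a, j) / A $$ (a, b))" for j
  have xw: "A $$ (i, j) = x i * cnj (w j)" if "i < n" "j < n" for i j
    using rank_le_1_imp_minor_zero[OF A rank that(1) ab(1) that(2) ab(2)] ab(3)
    by (simp add: x_def w_def field_simps)
  define X where "X = (\<Sum>i<n. (cmod (x i))\<^sup>2)"
  define W where "W = (\<Sum>i<n. (cmod (w i))\<^sup>2)"
  have X: "X > 0" unfolding X_def
    by (rule sum_pos2[of _ a]) (use ab in \<open>auto simp: x_def\<close>)
  have W: "W > 0" unfolding W_def
    by (rule sum_pos2[of _ b]) (use ab in \<open>auto simp: w_def\<close>)
  \<comment> \<open>Rescaling by \<open>t\<close> and \<open>1 / t\<close> turns the squared norms into \<open>t\<^sup>2 X\<close> and \<open>W / t\<^sup>2\<close>.\<close>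
  define t where "t = sqrt (sqrt (W / X))"
  have t: "t > 0" using X W by (simp add: t_def)
  have t4: "t\<^sup>2 * t\<^sup>2 = W / X" using X W by (simp add: t_def)
  have "t\<^sup>2 * X = W / t\<^sup>2" using t4 t X by (simp add: field_simps)
  moreover have "(\<Sum>i<n. (cmod (complex_of_real t * x i))\<^sup>2) = t\<^sup>2 * X"
    by (simp add: X_def norm_mult power_mult_distrib sum_distrib_left)
  moreover have "(\<Sum>i<n. (cmod (w i / complex_of_real t))\<^sup>2) = W / t\<^sup>2"
    by (simp add: W_def norm_divide power_divide sum_divide_distrib)
  moreover have "\<forall>i<n. \<forall>j<n. A $$ (i, j) = (complex_of_real t * x i) * cnj (w j / complex_of_real t)"
    using xw t by simp
  ultimately show ?thesis
    by (intro exI[of _ "\<lambda>i. complex_of_real t * x i"] exI[of _ "\<lambda>j. w j / complex_of_real t"]) simp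
qed

section \<open>Families of rank-one matrices\<close>

lemma rank_one_adjoint_mult_self:
  fixes x w :: "nat \<Rightarrow> complex"
  assumes A: "A \<in> carrier_mat n n" and xw: "\<And>i j. i < n \<Longrightarrow> j < n \<Longrightarrow> A $$ (i, j) = x i * cnj (w j)"
  shows "mat_adjoint A * A
    = complex_of_real (\<Sum>i<n. (cmod (x i))\<^sup>2) \<cdot>\<^sub>m (mat n 1 (\<lambda>(i, _). w i) * mat_adjoint (mat n 1 (\<lambda>(i, _). w i)))"
    (is "_ = ?c \<cdot>\<^sub>m (?W * mat_adjoint ?W)")
proof (rule eq_matI)
  have W: "?W \<in> carrier_mat n 1" by simp
  fix i j assume "i < dim_row (?c \<cdot>\<^sub>m (?W * mat_adjoint ?W))" "j < dim_col (?c \<cdot>\<^sub>m (?W * mat_adjoint ?W))"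
  hence ij: "i < n" "j < n" by auto
  have "(mat_adjoint A * A) $$ (i, j) = (\<Sum>l<n. (x l * cnj (x l)) * (w i * cnj (w j)))"
    using ij carrier_matD[OF A] by (subst mat_mult_index[OF mat_adjoint_carrier[OF A] A])
      (auto simp: mat_adjoint_index xw intro!: sum.cong)
  also have "\<dots> = ?c * (w i * cnj (w j))"
    unfolding of_real_sum complex_norm_square by (rule sum_distrib_right[symmetric])
  also have "w i * cnj (w j) = (?W * mat_adjoint ?W) $$ (i, j)"
    using ij by (subst mat_mult_index[OF W mat_adjoint_carrier[OF W]]) (auto simp: mat_adjoint_index)
  finally show "(mat_adjoint A * A) $$ (i, j) = (?c \<cdot>\<^sub>m (?W * mat_adjoint ?W)) $$ (i, j)"
    using ij by (simp del: index_mult_mat(1))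
qed (use A in auto)

text \<open>
  The trivial diagonalization of a \<open>1 \<times> 1\<close> Gram matrix, in the form that
  \<open>gram_spectra_agree\<close> takes: it yields the spectrum of a rank-one matrix \<open>W W\<^sup>*\<close>.
\<close>
lemma gram_of_column:
  fixes n :: nat and w :: "nat \<Rightarrow> complex"
  defines "W \<equiv> mat n 1 (\<lambda>(i, _). w i)"
  shows "mat_adjoint W * W = 1\<^sub>m 1 * (real_diag 1 (\<lambda>_. \<Sum>i<n. (cmod (w i))\<^sup>2) * mat_adjoint (1\<^sub>m 1))"
proof -
  have W: "W \<in> carrier_mat n 1" by (simp add: W_def)
  have "mat_adjoint W * W = real_diag 1 (\<lambda>_. \<Sum>i<n. (cmod (w i))\<^sup>2)"
    using gram_index_diag(2)[OF W, of 0] W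
    by (intro eq_matI) (auto simp: mat_diag_entry W_def simp del: index_mult_mat(1))
  thus ?thesis by simp
qed

lemma mat_abs_rank_one:
  fixes x w :: "nat \<Rightarrow> complex"
  assumes A: "A \<in> carrier_mat n n" and xw: "\<And>i j. i < n \<Longrightarrow> j < n \<Longrightarrow> A $$ (i, j) = x i * cnj (w j)"
    and bal: "(\<Sum>i<n. (cmod (x i))\<^sup>2) = (\<Sum>i<n. (cmod (w i))\<^sup>2)"
    and ij: "i < n" "j < n"
  shows "mat_abs A $$ (i, j) = w i * cnj (w j)"
proof -
  define W where "W = mat n 1 (\<lambda>(i, _). w i)"
  have W: "W \<in> carrier_mat n 1" by (simp add: W_def)
  have WW: "(W * mat_adjoint W) $$ (i, j) = w i * cnj (w j)" if "i < n" "j < n" for i j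
    using that by (subst mat_mult_index[OF W mat_adjoint_carrier[OF W]]) (auto simp: mat_adjoint_index W_def)
  have c: "W * mat_adjoint W \<in> carrier_mat n n" using W by auto
  have "mat_adjoint (W * mat_adjoint W) * (W * mat_adjoint W)
      = complex_of_real (\<Sum>i<n. (cmod (w i))\<^sup>2) \<cdot>\<^sub>m (W * mat_adjoint W)"
    unfolding W_def by (rule rank_one_adjoint_mult_self) (use c WW in \<open>auto simp: W_def simp del: index_mult_mat(1)\<close>)
  hence "mat_adjoint A * A = (W * mat_adjoint W) * (W * mat_adjoint W)"
    using rank_one_adjoint_mult_self[OF A xw] bal by (simp add: W_def mat_adjoint_times)
  hence "mat_abs A = W * mat_adjoint W" by (rule abs_square_root_eq[OF W])
  thus ?thesis using WW[OF ij] by simp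
qed

lemma schatten_norm_rank_one:
  fixes u w :: "nat \<Rightarrow> complex"
  assumes p: "p > 0" and A: "A \<in> carrier_mat n n"
    and uw: "\<And>i j. i < n \<Longrightarrow> j < n \<Longrightarrow> A $$ (i, j) = u i * cnj (w j)"
    and u: "(\<Sum>i<n. (cmod (u i))\<^sup>2) = 1"
  shows "schatten_norm p A = sqrt (\<Sum>i<n. (cmod (w i))\<^sup>2)"
proof -
  define W where "W = mat n 1 (\<lambda>(i, _). w i)"
  define c where "c = (\<Sum>i<n. (cmod (w i))\<^sup>2)"
  have c0: "c \<ge> 0" unfolding c_def by (intro sum_nonneg) auto
  have W: "W \<in> carrier_mat n 1" by (simp add: W_def)
  obtain U d where U: "unitary_mat n U" and d: "\<And>i. i < n \<Longrightarrow> d i \<ge> (0::real)"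
    and eq: "W * mat_adjoint W = U * (real_diag n d * mat_adjoint U)"
    using gram_unitary_diagonalization[OF mat_adjoint_carrier[OF W]] by auto
  have "mat_adjoint A * A = W * mat_adjoint W"
    using rank_one_adjoint_mult_self[OF A uw] u by (auto simp: W_def intro!: eq_matI simp del: index_mult_mat(1))
  hence "schatten_norm p A = (\<Sum>i<n. d i powr (p / 2)) powr (1 / p)"
    using eq by (intro schatten_norm_eq[OF U d]) auto
  also have "(\<Sum>i<n. d i powr (p / 2)) = (\<Sum>k<1::nat. c powr (p / 2))"
    unfolding c_def
    by (rule gram_spectra_agree[OF W U unitary_mat_one eq gram_of_column[of n w, folded W_def]]) simp
  also have "(\<Sum>k<1::nat. c powr (p / 2)) powr (1 / p) = sqrt c"
    using p c0 by (simp add: powr_powr powr_half_sqrt)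
  finally show ?thesis by (simp add: c_def)
qed

text \<open>
  Subtracting \<open>a\<close> from the Gram matrix leaves a matrix with all entries \<open>b\<close>, whose
  eigenvalues are \<open>m b\<close> and, \<open>m - 1\<close> times, \<open>0\<close>. So those of the Gram matrix are \<open>a + m b\<close> and,
  \<open>m - 1\<close> times, \<open>a\<close>.
\<close>
lemma schatten_norm_equicorrelated:
  fixes a b :: real
  assumes V: "V \<in> carrier_mat n m" and m: "m \<ge> 1" and b: "b \<ge> 0"
    and G: "\<And>j k. j < m \<Longrightarrow> k < m \<Longrightarrow>
      (mat_adjoint V * V) $$ (j, k) = complex_of_real ((if j = k then a else 0) + b)"
  shows "schatten_norm p (V * mat_adjoint V)
    = ((a + real m * b) powr p + (real m - 1) * a powr p) powr (1 / p)"
proof -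
  obtain F g where F: "unitary_mat m F" and g: "\<And>k. k < m \<Longrightarrow> g k \<ge> (0::real)"
    and eq: "mat_adjoint V * V = F * (real_diag m g * mat_adjoint F)"
    using gram_unitary_diagonalization[OF V] by blast
  have Fc: "F \<in> carrier_mat m m" using F by simp
  define K where "K = mat m 1 (\<lambda>(i, _). complex_of_real (sqrt b))"
  have K: "K \<in> carrier_mat m 1" by (simp add: K_def)
  have KK: "K * mat_adjoint K = F * (real_diag m (\<lambda>k. g k - a) * mat_adjoint F)"
  proof (rule eq_matI)
    fix j k assume "j < dim_row (F * (real_diag m (\<lambda>k. g k - a) * mat_adjoint F))"
      "k < dim_col (F * (real_diag m (\<lambda>k. g k - a) * mat_adjoint F))"
    hence jk: "j < m" "k < m" using Fc by auto
    have one: "(\<Sum>l<m. F $$ (j, l) * cnj (F $$ (k, l))) = (if j = k then 1 else 0)"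
    proof -
      have "(\<Sum>l<m. F $$ (j, l) * cnj (F $$ (k, l))) = (F * mat_adjoint F) $$ (j, k)"
        using jk carrier_matD[OF Fc]
        by (subst mat_mult_index[OF Fc mat_adjoint_carrier[OF Fc]]) (auto simp: mat_adjoint_index)
      thus ?thesis using jk by (simp add: unitary_mat_rewrites(3)[OF F])
    qed
    have "(F * (real_diag m (\<lambda>k. g k - a) * mat_adjoint F)) $$ (j, k)
        = (F * (real_diag m g * mat_adjoint F)) $$ (j, k)
          - complex_of_real a * (\<Sum>l<m. F $$ (j, l) * cnj (F $$ (k, l)))"
      unfolding diag_sandwich_index[OF Fc jk]
      by (simp add: sum_distrib_left sum_subtractf left_diff_distrib)
    also have "\<dots> = complex_of_real b"
      unfolding eq[symmetric] one by (simp add: G[OF jk] del: index_mult_mat(1))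
    also have "\<dots> = (K * mat_adjoint K) $$ (j, k)"
      using jk b by (subst mat_mult_index[OF K mat_adjoint_carrier[OF K]])
        (auto simp: mat_adjoint_index K_def simp flip: of_real_mult)
    finally show "(K * mat_adjoint K) $$ (j, k)
      = (F * (real_diag m (\<lambda>k. g k - a) * mat_adjoint F)) $$ (j, k)" ..
  qed (use Fc K in auto)
  have "(\<Sum>k<m. (g k - a + a) powr p - a powr p)
      = (\<Sum>k<1::nat. ((\<Sum>i<m. (cmod (complex_of_real (sqrt b)))\<^sup>2) + a) powr p - a powr p)"
    by (rule gram_spectra_agree[OF K F unitary_mat_one KK gram_of_column[of m "\<lambda>_. complex_of_real (sqrt b)", folded K_def],
          of "\<lambda>t. (t + a) powr p - a powr p"]) simp
  hence "(\<Sum>k<m. g k powr p) = (a + real m * b) powr p + (real m - 1) * a powr p"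
    using b by (simp add: sum_subtractf algebra_simps)
  thus ?thesis using schatten_norm_gram[OF V F g eq] by simp
qed

text \<open>
  Collecting the balanced factors as the columns of \<open>X\<close> and \<open>V\<close> turns the two sums into matrix
  products, which reduces the theorem to \<open>factored_bound\<close>.
\<close>
lemma msum_factored:
  assumes X: "X \<in> carrier_mat n m" and V: "V \<in> carrier_mat n m"
    and A: "\<And>k. k < m \<Longrightarrow> A k \<in> carrier_mat n n"
    and XV: "\<And>k i j. k < m \<Longrightarrow> i < n \<Longrightarrow> j < n \<Longrightarrow> A k $$ (i, j) = X $$ (i, k) * cnj (V $$ (j, k))"
    and cols: "\<And>k. k < m \<Longrightarrow> (\<Sum>i<n. (cmod (X $$ (i, k)))\<^sup>2) = (\<Sum>i<n. (cmod (V $$ (i, k)))\<^sup>2)"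
  shows "msum n m A = X * mat_adjoint V" and "msum n m (\<lambda>k. mat_abs (A k)) = V * mat_adjoint V"
proof -
  have prod: "(Z * mat_adjoint V) $$ (i, j) = (\<Sum>k<m. Z $$ (i, k) * cnj (V $$ (j, k)))"
    if Z: "Z \<in> carrier_mat n m" and "i < n" "j < n" for Z i j
    using that V by (subst mat_mult_index[OF Z mat_adjoint_carrier[OF V]]) (auto simp: mat_adjoint_index)
  show "msum n m A = X * mat_adjoint V"
    by (rule eq_matI) (use X V in \<open>auto simp: msum_def prod XV simp del: index_mult_mat(1)\<close>)
  have "mat_abs (A k) $$ (i, j) = V $$ (i, k) * cnj (V $$ (j, k))" if "k < m" "i < n" "j < n" for k i j
    by (rule mat_abs_rank_one[OF A[OF that(1)] XV[OF that(1)] cols[OF that(1)] that(2,3)])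
  thus "msum n m (\<lambda>k. mat_abs (A k)) = V * mat_adjoint V"
    by (intro eq_matI) (use V in \<open>auto simp: msum_def prod simp del: index_mult_mat(1)\<close>)
qed

lemma rank_one_family_factorization:
  assumes fam: "rank_one_family n m A"
  obtains X V where "X \<in> carrier_mat n m" "V \<in> carrier_mat n m"
    "\<And>k i j. k < m \<Longrightarrow> i < n \<Longrightarrow> j < n \<Longrightarrow> A k $$ (i, j) = X $$ (i, k) * cnj (V $$ (j, k))"
    "\<And>k. k < m \<Longrightarrow> (\<Sum>i<n. (cmod (X $$ (i, k)))\<^sup>2) = (\<Sum>i<n. (cmod (V $$ (i, k)))\<^sup>2)"
    "frob_sq V > 0"
proof -
  have A: "A k \<in> carrier_mat n n" "vec_space.rank n (A k) \<le> 1" if "k < m" for k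
    using fam that by (auto simp: rank_one_family_def)
  have "\<forall>k. \<exists>x w. k < m \<longrightarrow> (\<forall>i<n. \<forall>j<n. A k $$ (i, j) = x i * cnj (w j)) \<and>
     (\<Sum>i<n. (cmod (x i))\<^sup>2) = (\<Sum>i<n. (cmod (w i))\<^sup>2)"
    using rank_le_1_balanced_factorization[OF A] by blast
  then obtain x w where xw: "\<And>k i j. k < m \<Longrightarrow> i < n \<Longrightarrow> j < n \<Longrightarrow> A k $$ (i, j) = x k i * cnj (w k j)"
    and bal: "\<And>k. k < m \<Longrightarrow> (\<Sum>i<n. (cmod (x k i))\<^sup>2) = (\<Sum>i<n. (cmod (w k i))\<^sup>2)"
    by metis
  define X where "X = mat n m (\<lambda>(i, k). x k i)"
  define V where "V = mat n m (\<lambda>(i, k). w k i)"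
  have V: "V \<in> carrier_mat n m" by (simp add: V_def)
  obtain k where k: "k < m" "A k \<noteq> 0\<^sub>m n n" using fam by (auto simp: rank_one_family_def)
  have "\<exists>i<n. \<exists>j<n. A k $$ (i, j) \<noteq> 0"
  proof (rule ccontr)
    assume "\<not> ?thesis"
    hence "A k = 0\<^sub>m n n" using A(1)[OF k(1)] by (intro eq_matI) auto
    thus False using k by simp
  qed
  then obtain j where j: "j < n" "w k j \<noteq> 0" using xw[OF k(1)] by fastforce
  have colpos: "(\<Sum>i<n. (cmod (V $$ (i, k)))\<^sup>2) > 0"
    by (rule sum_pos2[of _ j]) (use j k in \<open>auto simp: V_def\<close>)
  have "frob_sq V > 0"
    unfolding frob_sq_columns[OF V] by (rule sum_pos2[of _ k]) (use k colpos in \<open>auto intro: sum_nonneg\<close>)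
  thus ?thesis
    by (intro that[of X V]) (auto simp: X_def V_def xw bal)
qed

section \<open>The extremal families\<close>

lemma cscalar_prod_sum:
  fixes u v :: "complex vec"
  assumes "u \<in> carrier_vec n" "v \<in> carrier_vec n"
  shows "u \<bullet>c v = (\<Sum>i<n. u $ i * cnj (v $ i))"
  using assms by (auto simp: scalar_prod_def lessThan_atLeast0 intro!: sum.cong)

lemma cscalar_prod_self:
  fixes u :: "complex vec"
  assumes "u \<in> carrier_vec n"
  shows "u \<bullet>c u = complex_of_real (\<Sum>i<n. (cmod (u $ i))\<^sup>2)"
  unfolding cscalar_prod_sum[OF assms assms] of_real_sum complex_norm_square ..

lemma tz_s_bounds:
  assumes p: "p \<ge> 2" and m: "m \<ge> 2"
  shows "0 < tz_s p m" "tz_s p m < 1"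
  using tz_x_gt_1[OF p m] m by (auto simp: tz_s_def)

text \<open>
  Comparing the column norms of \<open>X\<close> with the diagonal of \<open>V\<^sup>* V\<close> gives a linear equation for
  \<open>\<bar>f k\<bar>\<^sup>2\<close> with the same coefficients for every \<open>k\<close>; since these numbers add up to \<open>1\<close>, each of them is \<open>1 / m\<close>.
  So the columns of \<open>V\<close> have equal norms, and moving the phase of \<open>f k\<close> from the left factor to the
  right one leaves a common left factor and equal inner products.
\<close>
lemma equality_imp_tz_extremal:
  assumes p: "p \<ge> 2" and m: "m \<ge> 2"
    and X: "X \<in> carrier_mat n m" and V: "V \<in> carrier_mat n m"
    and A: "\<And>k. k < m \<Longrightarrow> A k \<in> carrier_mat n n"
    and XV: "\<And>k i j. k < m \<Longrightarrow> i < n \<Longrightarrow> j < n \<Longrightarrow> A k $$ (i, j) = X $$ (i, k) * cnj (V $$ (j, k))"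
    and cols: "\<And>k. k < m \<Longrightarrow> (\<Sum>i<n. (cmod (X $$ (i, k)))\<^sup>2) = (\<Sum>i<n. (cmod (V $$ (i, k)))\<^sup>2)"
    and \<nu>: "\<nu> > 0" and f1: "(\<Sum>k<m. (cmod (f k))\<^sup>2) = 1"
    and Xf: "\<And>i k. i < n \<Longrightarrow> k < m \<Longrightarrow> X $$ (i, k) = y i * cnj (f k)"
    and Gf: "\<And>j k. j < m \<Longrightarrow> k < m \<Longrightarrow> (mat_adjoint V * V) $$ (j, k) =
          complex_of_real \<nu> * (if j = k then 1 else 0)
          + complex_of_real ((tz_x p m - 1) * \<nu>) * (f j * cnj (f k))"
  shows "tz_extremal p n m A"
proof -
  define x where "x = tz_x p m"
  define T where "T = (\<Sum>i<n. (cmod (y i))\<^sup>2)"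
  have x1: "x > 1" unfolding x_def by (rule tz_x_gt_1[OF p m])
  have colk: "T * (cmod (f k))\<^sup>2 = \<nu> + (x - 1) * \<nu> * (cmod (f k))\<^sup>2" if k: "k < m" for k
  proof -
    have "T * (cmod (f k))\<^sup>2 = (\<Sum>i<n. (cmod (X $$ (i, k)))\<^sup>2)"
      unfolding T_def sum_distrib_right using k by (intro sum.cong) (auto simp: Xf norm_mult power_mult_distrib)
    also have "\<dots> = (\<Sum>i<n. (cmod (V $$ (i, k)))\<^sup>2)" by (rule cols[OF k])
    finally have "complex_of_real (T * (cmod (f k))\<^sup>2) = (mat_adjoint V * V) $$ (k, k)"
      using gram_index_diag(2)[OF V k] by simp
    also have "\<dots> = complex_of_real (\<nu> + (x - 1) * \<nu> * (cmod (f k))\<^sup>2)"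
      using Gf[OF k k] by (simp add: x_def complex_norm_square del: index_mult_mat(1) of_real_power)
    finally show ?thesis by (simp only: of_real_eq_iff)
  qed
  have "T * (\<Sum>k<m. (cmod (f k))\<^sup>2) = (\<Sum>k<m. \<nu>) + (x - 1) * \<nu> * (\<Sum>k<m. (cmod (f k))\<^sup>2)"
    unfolding sum_distrib_left sum.distrib[symmetric] by (rule sum.cong[OF refl]) (use colk in auto)
  hence T: "T = \<nu> * (x + real m - 1)" using f1 by (simp add: algebra_simps)
  have T0: "T > 0" unfolding T using x1 \<nu> by (intro mult_pos_pos) auto
  have fk: "(cmod (f k))\<^sup>2 = 1 / real m" if "k < m" for k
  proof -
    have "\<nu> * (real m * (cmod (f k))\<^sup>2) = \<nu> * 1"
      using colk[OF that] unfolding T by (simp add: algebra_simps)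
    hence "real m * (cmod (f k))\<^sup>2 = 1" using \<nu> by simp
    thus ?thesis using m by (simp add: field_simps)
  qed
  have ff: "f k * cnj (f k) = 1 / complex_of_real (real m)" if "k < m" for k
    using fk[OF that] by (simp flip: complex_norm_square)
  define r where "r = T / real m"
  define \<tau> where "\<tau> = sqrt T"
  have \<tau>: "\<tau> > 0" "\<tau> * \<tau> = T" using T0 by (auto simp: \<tau>_def)
  define u where "u = vec n (\<lambda>i. y i / complex_of_real \<tau>)"
  define v where "v k = vec n (\<lambda>i. f k * V $$ (i, k) * complex_of_real (real m / \<tau>))" for k
  have uc: "u \<in> carrier_vec n" and vc: "v k \<in> carrier_vec n" for k by (auto simp: u_def v_def)
  have "(\<Sum>i<n. (cmod (u $ i))\<^sup>2) = T / (\<tau> * \<tau>)"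
    unfolding T_def by (simp add: u_def norm_divide power_divide sum_divide_distrib power2_eq_square)
  hence u1: "u \<bullet>c u = 1" using \<tau> T0 by (simp add: cscalar_prod_self[OF uc])
  have Av: "A k = complex_of_real r \<cdot>\<^sub>m outer_prod u (v k)" if k: "k < m" for k
  proof (rule eq_matI)
    fix i j assume "i < dim_row (complex_of_real r \<cdot>\<^sub>m outer_prod u (v k))"
      "j < dim_col (complex_of_real r \<cdot>\<^sub>m outer_prod u (v k))"
    hence ij: "i < n" "j < n" by (auto simp: outer_prod_def u_def v_def)
    have "complex_of_real r * (complex_of_real (real m / \<tau>) / complex_of_real \<tau>) = 1"
    proof -
      have "r * (real m / \<tau> / \<tau>) = 1" using \<tau> T0 m by (simp add: r_def)
      thus ?thesis by (metis of_real_1 of_real_divide of_real_mult)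
    qed
    moreover have "(complex_of_real r \<cdot>\<^sub>m outer_prod u (v k)) $$ (i, j)
        = (complex_of_real r * (complex_of_real (real m / \<tau>) / complex_of_real \<tau>))
          * (y i * cnj (f k) * cnj (V $$ (j, k)))"
      using ij by (simp add: outer_prod_def u_def v_def)
    ultimately show "A k $$ (i, j) = (complex_of_real r \<cdot>\<^sub>m outer_prod u (v k)) $$ (i, j)"
      using XV[OF k ij] Xf[OF ij(1) k] by simp
  qed (use A[OF k] in \<open>auto simp: outer_prod_def u_def v_def\<close>)
  have vv: "v j \<bullet>c v k = (if j = k then 1 else complex_of_real (tz_s p m))" if jk: "j < m" "k < m" for j k
  proof -
    have G: "(mat_adjoint V * V) $$ (k, j) = (\<Sum>i<n. V $$ (i, j) * cnj (V $$ (i, k)))"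
      using jk V by (subst mat_mult_index[OF mat_adjoint_carrier[OF V] V])
        (auto simp: mat_adjoint_index mult.commute)
    have "v j \<bullet>c v k = complex_of_real (real m / \<tau> * (real m / \<tau>)) * (f j * cnj (f k))
        * (mat_adjoint V * V) $$ (k, j)"
      unfolding G cscalar_prod_sum[OF vc vc] sum_distrib_left
      by (intro sum.cong) (auto simp: v_def)
    also have "real m / \<tau> * (real m / \<tau>) = (real m)\<^sup>2 / T"
      using \<tau> by (simp add: power2_eq_square)
    also have "complex_of_real ((real m)\<^sup>2 / T) * (f j * cnj (f k)) * (mat_adjoint V * V) $$ (k, j)
        = complex_of_real ((real m)\<^sup>2 / T) * (complex_of_real \<nu> * (if j = k then f k * cnj (f k) else 0)
          + complex_of_real ((x - 1) * \<nu>) * ((f j * cnj (f j)) * (f k * cnj (f k))))"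
      unfolding Gf[OF jk(2,1)] x_def[symmetric] by (simp add: algebra_simps)
    also have "\<dots> = complex_of_real ((real m)\<^sup>2 / T * (\<nu> * (if j = k then 1 / real m else 0)
          + (x - 1) * \<nu> * (1 / real m * (1 / real m))))"
      unfolding ff[OF jk(1)] ff[OF jk(2)] by simp
    also have "(real m)\<^sup>2 / T * (\<nu> * (if j = k then 1 / real m else 0)
          + (x - 1) * \<nu> * (1 / real m * (1 / real m))) = (if j = k then 1 else tz_s p m)"
    proof -
      have xm: "x + real m - 1 > 0" using x1 by simp
      have "(real m)\<^sup>2 / T * (\<nu> * a + (x - 1) * \<nu> * b)
          = \<nu> / T * ((real m)\<^sup>2 * a + (x - 1) * ((real m)\<^sup>2 * b))" for a b
        using T0 by (simp add: field_simps)
      moreover have "(real m)\<^sup>2 * (if j = k then 1 / real m else 0) = (if j = k then real m else 0)"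
        by (simp add: power2_eq_square)
      moreover have "(real m)\<^sup>2 * (1 / real m * (1 / real m)) = 1"
        using m by (simp add: power2_eq_square)
      moreover have "\<nu> / T = 1 / (x + real m - 1)" unfolding T using \<nu> by simp
      ultimately have "(real m)\<^sup>2 / T * (\<nu> * (if j = k then 1 / real m else 0)
          + (x - 1) * \<nu> * (1 / real m * (1 / real m)))
          = ((if j = k then real m else 0) + (x - 1)) / (x + real m - 1)"
        by (simp only:) simp
      thus ?thesis using xm by (simp add: tz_s_def x_def)
    qed
    finally show ?thesis by (cases "j = k") auto
  qed
  have "r > 0" using T0 m by (simp add: r_def)
  thus ?thesis unfolding tz_extremal_def using uc vc u1 Av vv by blast
qed

text \<open>
  Both sides are computed: the sum of the \<open>A k\<close> has rank one, and the Gram matrix of the right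
  factors is equicorrelated. The constant \<open>c = r m / (x + m - 1)\<close> is its smaller eigenvalue, the
  larger one being \<open>x c\<close>.
\<close>
lemma tz_extremal_imp_equality:
  assumes p: "p \<ge> 2" and m: "m \<ge> 2" and ext: "tz_extremal p n m A"
  shows "schatten_norm p (msum n m A) = tz_const p m * schatten_norm p (msum n m (\<lambda>k. mat_abs (A k)))"
proof -
  obtain r u v where r: "r > 0" and uc: "u \<in> carrier_vec n" and u1: "u \<bullet>c u = 1"
    and vc: "\<And>k. k < m \<Longrightarrow> v k \<in> carrier_vec n"
    and Av: "\<And>k. k < m \<Longrightarrow> A k = complex_of_real r \<cdot>\<^sub>m outer_prod u (v k)"
    and vv: "\<And>j k. j < m \<Longrightarrow> k < m \<Longrightarrow> v j \<bullet>c v k = (if j = k then 1 else complex_of_real (tz_s p m))"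
    using ext unfolding tz_extremal_def by blast
  define x where "x = tz_x p m"
  define s where "s = tz_s p m"
  \<comment> \<open>Dividing the scale evenly between the two factors balances them.\<close>
  define \<rho> where "\<rho> = complex_of_real (sqrt r)"
  have \<rho>: "\<rho> * \<rho> = complex_of_real r" "cnj \<rho> = \<rho>" using r by (simp_all add: \<rho>_def flip: of_real_mult)
  define X where "X = mat n m (\<lambda>(i, k). \<rho> * u $ i)"
  define V where "V = mat n m (\<lambda>(i, k). \<rho> * v k $ i)"
  have X: "X \<in> carrier_mat n m" and V: "V \<in> carrier_mat n m" by (auto simp: X_def V_def)
  have A: "A k \<in> carrier_mat n n" if "k < m" for k
    unfolding Av[OF that] using uc vc[OF that] by (auto simp: outer_prod_def)
  have Aij: "A k $$ (i, j) = complex_of_real r * (u $ i * cnj (v k $ j))" if "k < m" "i < n" "j < n" for k i j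
    unfolding Av[OF that(1)] using that uc vc[OF that(1)] by (auto simp: outer_prod_def)
  have XV: "A k $$ (i, j) = X $$ (i, k) * cnj (V $$ (j, k))" if "k < m" "i < n" "j < n" for k i j
    unfolding Aij[OF that] \<rho>(1)[symmetric] using that by (simp add: X_def V_def \<rho>)
  have uN: "(\<Sum>i<n. (cmod (u $ i))\<^sup>2) = 1"
    using u1 unfolding cscalar_prod_self[OF uc] by (simp only: of_real_eq_1_iff)
  have vN: "(\<Sum>i<n. (cmod (v k $ i))\<^sup>2) = 1" if "k < m" for k
  proof -
    have "complex_of_real (\<Sum>i<n. (cmod (v k $ i))\<^sup>2) = 1"
      unfolding cscalar_prod_self[OF vc[OF that], symmetric] using vv[OF that that] by simp
    thus ?thesis by (simp only: of_real_eq_1_iff)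
  qed
  have cols: "(\<Sum>i<n. (cmod (X $$ (i, k)))\<^sup>2) = (\<Sum>i<n. (cmod (V $$ (i, k)))\<^sup>2)" if "k < m" for k
    using that uN vN[OF that]
    by (simp add: X_def V_def norm_mult power_mult_distrib flip: sum_distrib_left)
  have S: "msum n m A = X * mat_adjoint V" "msum n m (\<lambda>k. mat_abs (A k)) = V * mat_adjoint V"
    using msum_factored[OF X V A XV cols] by blast+
  have x1: "x > 1" and xp: "x powr p = 2 * x + real m - 1"
    using tz_x_root[OF p m] by (simp_all add: x_def)
  have xm: "x + real m - 1 > 0" using x1 by simp
  define c where "c = r * real m / (x + real m - 1)"
  have c: "c > 0" using r m xm by (simp add: c_def)
  have sD: "s * (x + real m - 1) = x - 1" and cD: "c * (x + real m - 1) = r * real m"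
    using xm by (simp_all add: s_def tz_s_def c_def x_def)
  have "r * (1 - s) * (x + real m - 1) = r * ((x + real m - 1) - s * (x + real m - 1))"
    by (simp add: algebra_simps)
  also have "\<dots> = c * (x + real m - 1)" unfolding sD cD by simp
  finally have a: "r * (1 - s) = c" using xm by simp
  have "(c + real m * (r * s)) * (x + real m - 1)
      = c * (x + real m - 1) + real m * r * (s * (x + real m - 1))"
    by (simp add: algebra_simps)
  also have "\<dots> = x * (c * (x + real m - 1))" unfolding sD cD by (simp add: algebra_simps)
  finally have ab: "c + real m * (r * s) = x * c" using xm by simp
  have M: "x powr p + real m - 1 > 0" unfolding xp using x1 m by simp

  have "schatten_norm p (V * mat_adjoint V)
      = ((c + real m * (r * s)) powr p + (real m - 1) * c powr p) powr (1 / p)"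
  proof (rule schatten_norm_equicorrelated[OF V])
    show "1 \<le> m" "0 \<le> r * s" using m r tz_s_bounds[OF p m] by (auto simp: s_def)
    fix j k assume jk: "j < m" "k < m"
    have "(mat_adjoint V * V) $$ (j, k) = complex_of_real r * (v k \<bullet>c v j)"
      unfolding cscalar_prod_sum[OF vc[OF jk(2)] vc[OF jk(1)]] sum_distrib_left \<rho>(1)[symmetric]
      using jk by (subst mat_mult_index[OF mat_adjoint_carrier[OF V] V])
        (auto simp: mat_adjoint_index V_def \<rho> intro!: sum.cong)
    also have "\<dots> = complex_of_real ((if j = k then c else 0) + r * s)"
      unfolding a[symmetric] using vv[OF jk(2,1)] by (simp add: s_def algebra_simps)
    finally show "(mat_adjoint V * V) $$ (j, k) = complex_of_real ((if j = k then c else 0) + r * s)" .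
  qed
  also have "\<dots> = (c powr p * (x powr p + real m - 1)) powr (1 / p)"
    unfolding ab using c x1 by (simp add: powr_mult algebra_simps)
  also have "\<dots> = c * (x powr p + real m - 1) powr (1 / p)"
    using c p M by (simp add: powr_mult powr_powr)
  finally have rhs: "tz_const p m * schatten_norm p (V * mat_adjoint V) = sqrt (x * (x + real m - 1)) * c"
    using M by (simp add: tz_const_def x_def[symmetric])

  define w where "w j = (\<Sum>k<m. complex_of_real r * v k $ j)" for j
  have "schatten_norm p (msum n m A) = sqrt (\<Sum>j<n. (cmod (w j))\<^sup>2)"
  proof (rule schatten_norm_rank_one[OF _ _ _ uN])
    show "p > 0" "msum n m A \<in> carrier_mat n n" using p by (auto simp: msum_def)
    show "msum n m A $$ (i, j) = u $ i * cnj (w j)" if "i < n" "j < n" for i j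
      using that by (simp add: msum_def Aij w_def sum_distrib_left mult_ac)
  qed
  also have "(\<Sum>j<n. (cmod (w j))\<^sup>2) = x * (x + real m - 1) * c\<^sup>2"
  proof -
    have "complex_of_real (\<Sum>j<n. (cmod (w j))\<^sup>2)
        = (\<Sum>i<n. \<Sum>j<m. \<Sum>k<m. complex_of_real (r\<^sup>2) * (v j $ i * cnj (v k $ i)))"
      unfolding of_real_sum complex_norm_square w_def cnj_sum sum_product
      by (intro sum.cong refl) (simp add: power2_eq_square)
    also have "\<dots> = (\<Sum>j<m. \<Sum>k<m. complex_of_real (r\<^sup>2) * (v j \<bullet>c v k))"
    proof -
      have "(\<Sum>j<m. \<Sum>k<m. complex_of_real (r\<^sup>2) * (v j \<bullet>c v k))
          = (\<Sum>j<m. \<Sum>k<m. \<Sum>i<n. complex_of_real (r\<^sup>2) * (v j $ i * cnj (v k $ i)))"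
        by (intro sum.cong refl) (simp add: cscalar_prod_sum[OF vc vc] sum_distrib_left)
      also have "\<dots> = (\<Sum>j<m. \<Sum>i<n. \<Sum>k<m. complex_of_real (r\<^sup>2) * (v j $ i * cnj (v k $ i)))"
        by (intro sum.cong refl sum.swap)
      also have "\<dots> = (\<Sum>i<n. \<Sum>j<m. \<Sum>k<m. complex_of_real (r\<^sup>2) * (v j $ i * cnj (v k $ i)))"
        by (rule sum.swap)
      finally show ?thesis by (rule sym)
    qed
    also have "\<dots> = (\<Sum>j<m. \<Sum>k<m. complex_of_real (r\<^sup>2 * ((if j = k then 1 - s else 0) + s)))"
      by (intro sum.cong refl) (auto simp: vv s_def)
    also have "\<dots> = complex_of_real (\<Sum>j<m. \<Sum>k<m. r\<^sup>2 * ((if j = k then 1 - s else 0) + s))"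
      by (simp only: of_real_sum)
    finally have "(\<Sum>j<n. (cmod (w j))\<^sup>2) = (\<Sum>j<m. \<Sum>k<m. r\<^sup>2 * ((if j = k then 1 - s else 0) + s))"
      by (simp only: of_real_eq_iff)
    also have "\<dots> = real m * r * (r * (1 - s) + real m * (r * s))"
      by (simp add: sum.distrib distrib_left power2_eq_square algebra_simps flip: sum_distrib_left)
    also have "\<dots> = real m * r * (x * c)" unfolding a ab ..
    also have "real m * r = c * (x + real m - 1)" using xm by (simp add: c_def)
    finally show ?thesis by (simp add: power2_eq_square)
  qed
  also have "sqrt (x * (x + real m - 1) * c\<^sup>2) = sqrt (x * (x + real m - 1)) * c"
    using c by (simp add: real_sqrt_mult)
  finally show ?thesis unfolding S(2) rhs .
qed

lemma tz_extremal_rank_one_family: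
  assumes m: "m \<ge> 1" and ext: "tz_extremal p n m A"
  shows "rank_one_family n m A"
proof -
  obtain r u v where r: "(r::real) > 0" and uc: "u \<in> carrier_vec n" and u1: "u \<bullet>c u = 1"
    and vc: "\<And>k. k < m \<Longrightarrow> v k \<in> carrier_vec n"
    and Av: "\<And>k. k < m \<Longrightarrow> A k = complex_of_real r \<cdot>\<^sub>m outer_prod u (v k)"
    and vvs: "\<And>j k. j < m \<Longrightarrow> k < m \<Longrightarrow> v j \<bullet>c v k = (if j = k then 1 else complex_of_real (tz_s p m))"
    using ext unfolding tz_extremal_def by blast
  have vv: "v k \<bullet>c v k = 1" if "k < m" for k using vvs[OF that that] by simp
  have A: "A k \<in> carrier_mat n n" if "k < m" for k
    unfolding Av[OF that] using uc vc[OF that] by (auto simp: outer_prod_def)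
  have Aij: "A k $$ (i, j) = (complex_of_real r * u $ i) * cnj (v k $ j)" if "k < m" "i < n" "j < n" for k i j
    unfolding Av[OF that(1)] using that uc vc[OF that(1)] by (auto simp: outer_prod_def)
  have "vec_space.rank n (A k) \<le> 1" if "k < m" for k
    by (rule vec_space.rank_le_1_product_entries[OF A[OF that], of "\<lambda>i. complex_of_real r * u $ i" "\<lambda>j. cnj (v k $ j)"])
      (use A[OF that] Aij[OF that] in auto)
  moreover have "A 0 \<noteq> 0\<^sub>m n n"
  proof
    assume "A 0 = 0\<^sub>m n n"
    hence z: "u $ i * cnj (v 0 $ j) = 0" if "i < n" "j < n" for i j
      using Aij[of 0 i j] that m r by simp
    obtain i where i: "i < n" "u $ i \<noteq> 0"
      using u1 unfolding cscalar_prod_sum[OF uc uc] by (cases "\<forall>i<n. u $ i = 0") auto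
    have "v 0 \<bullet>c v 0 = 0"
      unfolding cscalar_prod_sum[OF vc vc, OF m[unfolded One_nat_def Suc_le_eq] m[unfolded One_nat_def Suc_le_eq]]
      using z[OF i(1)] i(2) by (intro sum.neutral) auto
    thus False using vv[of 0] m by simp
  qed
  moreover have "0 < m" using m by simp
  ultimately show ?thesis unfolding rank_one_family_def using A by blast
qed

text \<open>
  The vectors \<open>\<alpha> e\<^sub>k + \<beta> (e\<^sub>1 + \<dots> + e\<^sub>m)\<close> have inner products \<open>\<alpha>\<^sup>2 \<delta> + 2 \<alpha> \<beta> + m \<beta>\<^sup>2\<close>; the choice of
  \<open>\<alpha>\<close> fixes the first term, and \<open>\<beta>\<close> solves the remaining quadratic equation.
\<close>
lemma equiangular_vectors:
  fixes s :: real
  assumes s: "0 \<le> s" "s \<le> 1" and m: "m \<ge> 1" and mn: "m \<le> n"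
  shows "\<exists>v :: nat \<Rightarrow> complex vec. (\<forall>k. v k \<in> carrier_vec n) \<and>
    (\<forall>j<m. \<forall>k<m. v j \<bullet>c v k = (if j = k then 1 else complex_of_real s))"
proof -
  define \<alpha> where "\<alpha> = sqrt (1 - s)"
  define \<beta> where "\<beta> = (sqrt (1 - s + real m * s) - \<alpha>) / real m"
  have \<alpha>: "\<alpha>\<^sup>2 = 1 - s" using s by (simp add: \<alpha>_def)
  have "(\<alpha> + real m * \<beta>)\<^sup>2 = 1 - s + real m * s" using s m by (simp add: \<beta>_def)
  hence "real m * (2 * \<alpha> * \<beta> + real m * \<beta>\<^sup>2) = real m * s"
    using \<alpha> by (simp add: power2_eq_square algebra_simps)
  hence \<beta>: "2 * \<alpha> * \<beta> + real m * \<beta>\<^sup>2 = s" using m by simp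
  define c where "c k i = \<alpha> * (if i = k then 1 else 0) + (if i < m then \<beta> else 0)" for k i :: nat
  define v where "v k = vec n (\<lambda>i. complex_of_real (c k i))" for k
  have vc: "v k \<in> carrier_vec n" for k by (simp add: v_def)
  have "v j \<bullet>c v k = (if j = k then 1 else complex_of_real s)" if jk: "j < m" "k < m" for j k
  proof -
    have "v j \<bullet>c v k = complex_of_real (\<Sum>i<n. c j i * c k i)"
      unfolding cscalar_prod_sum[OF vc vc] of_real_sum by (intro sum.cong) (auto simp: v_def)
    also have "(\<Sum>i<n. c j i * c k i) = (\<Sum>i<m. c j i * c k i)"
      using mn jk by (intro sum.mono_neutral_right) (auto simp: c_def)
    also have "\<dots> = (\<Sum>i<m. (if i = k then (if j = k then \<alpha>\<^sup>2 else 0) else 0)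
        + (if i = j then \<alpha> * \<beta> else 0) + (if i = k then \<alpha> * \<beta> else 0) + \<beta>\<^sup>2)"
      by (intro sum.cong) (auto simp: c_def power2_eq_square algebra_simps)
    also have "\<dots> = (if j = k then 1 else s)"
      using jk \<alpha> \<beta> by (simp add: sum.distrib)
    finally show ?thesis by simp
  qed
  with vc show ?thesis by blast
qed

lemma tz_extremal_exists:
  assumes p: "p \<ge> 2" and m: "m \<ge> 2" and mn: "m \<le> n"
  shows "\<exists>A. tz_extremal p n m A"
proof -
  obtain v :: "nat \<Rightarrow> complex vec" where vc: "\<And>k. v k \<in> carrier_vec n"
    and vv: "\<And>j k. j < m \<Longrightarrow> k < m \<Longrightarrow> v j \<bullet>c v k = (if j = k then 1 else complex_of_real (tz_s p m))"
    using equiangular_vectors[of "tz_s p m" m n] tz_s_bounds[OF p m] m mn by auto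
  \<comment> \<open>Any unit vector serves as the common left factor.\<close>
  have "v 0 \<bullet>c v 0 = 1" using vv[of 0 0] m by simp
  hence "tz_extremal p n m (\<lambda>k. complex_of_real 1 \<cdot>\<^sub>m outer_prod (v 0) (v k))"
    unfolding tz_extremal_def using vc vv by (intro exI[of _ 1] exI[of _ "v 0"] exI[of _ v]) auto
  thus ?thesis by blast
qed

lemma rank_one_family_bound:
  assumes p: "p \<ge> 2" and m: "m \<ge> 2" and fam: "rank_one_family n m A"
  shows "schatten_norm p (msum n m A) \<le> tz_const p m * schatten_norm p (msum n m (\<lambda>k. mat_abs (A k)))"
    and "schatten_norm p (msum n m (\<lambda>k. mat_abs (A k))) > 0"
    and "schatten_norm p (msum n m A) = tz_const p m * schatten_norm p (msum n m (\<lambda>k. mat_abs (A k)))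
      \<Longrightarrow> m \<le> n \<and> tz_extremal p n m A"
proof -
  obtain X V where X: "X \<in> carrier_mat n m" and V: "V \<in> carrier_mat n m"
    and XV: "\<And>k i j. k < m \<Longrightarrow> i < n \<Longrightarrow> j < n \<Longrightarrow> A k $$ (i, j) = X $$ (i, k) * cnj (V $$ (j, k))"
    and cols: "\<And>k. k < m \<Longrightarrow> (\<Sum>i<n. (cmod (X $$ (i, k)))\<^sup>2) = (\<Sum>i<n. (cmod (V $$ (i, k)))\<^sup>2)"
    and pos: "frob_sq V > 0"
    using rank_one_family_factorization[OF fam] by blast
  have A: "A k \<in> carrier_mat n n" if "k < m" for k
    using fam that by (auto simp: rank_one_family_def)
  have S: "msum n m A = X * mat_adjoint V" "msum n m (\<lambda>k. mat_abs (A k)) = V * mat_adjoint V"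
    using msum_factored[OF X V A XV cols] by blast+
  show "schatten_norm p (msum n m A) \<le> tz_const p m * schatten_norm p (msum n m (\<lambda>k. mat_abs (A k)))"
    unfolding S by (rule factored_bound(1)[OF p m X V cols pos])
  show "schatten_norm p (msum n m (\<lambda>k. mat_abs (A k))) > 0"
    unfolding S by (rule schatten_norm_gram_pos[OF V pos])
  assume "schatten_norm p (msum n m A) = tz_const p m * schatten_norm p (msum n m (\<lambda>k. mat_abs (A k)))"
  hence "schatten_norm p (X * mat_adjoint V) = tz_const p m * schatten_norm p (V * mat_adjoint V)"
    unfolding S .
  with factored_bound(2)[OF p m X V cols pos] obtain \<nu> y f where mn: "m \<le> n" and \<nu>: "\<nu> > 0"
    and f: "(\<Sum>k<m. (cmod (f k))\<^sup>2) = 1"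
      "\<And>i k. i < n \<Longrightarrow> k < m \<Longrightarrow> X $$ (i, k) = y i * cnj (f k)"
      "\<And>j k. j < m \<Longrightarrow> k < m \<Longrightarrow> (mat_adjoint V * V) $$ (j, k) =
          complex_of_real \<nu> * (if j = k then 1 else 0)
          + complex_of_real ((tz_x p m - 1) * \<nu>) * (f j * cnj (f k))"
    by blast
  have "tz_extremal p n m A"
    by (rule equality_imp_tz_extremal[OF p m X V A XV cols \<nu> f])
  with mn show "m \<le> n \<and> tz_extremal p n m A" ..
qed

section \<open>The sharp inequality\<close>

theorem theorem1p2:
  fixes p :: real and m :: nat
  assumes "m \<ge> 2" and "p \<ge> 2"
  shows
    "(\<forall>n A. rank_one_family n m A \<longrightarrow>
        schatten_norm p (msum n m A)
          \<le> tz_const p m * schatten_norm p (msum n m (\<lambda>k. mat_abs (A k)))) \<and>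
     (\<forall>c::real.
        (\<forall>n\<ge>1. \<forall>A. rank_one_family n m A \<longrightarrow>
           schatten_norm p (msum n m A)
             \<le> c * schatten_norm p (msum n m (\<lambda>k. mat_abs (A k))))
        \<longrightarrow> tz_const p m \<le> c) \<and>
     (\<forall>n\<ge>m. \<exists>A. rank_one_family n m A \<and>
        schatten_norm p (msum n m A)
          = tz_const p m * schatten_norm p (msum n m (\<lambda>k. mat_abs (A k)))) \<and>
     (\<forall>n A. rank_one_family n m A \<longrightarrow>
        (schatten_norm p (msum n m A)
           = tz_const p m * schatten_norm p (msum n m (\<lambda>k. mat_abs (A k)))
         \<longleftrightarrow> tz_extremal p n m A)) \<and>
     (\<forall>n A. rank_one_family n m A \<and>
        schatten_norm p (msum n m A)
          = tz_const p m * schatten_norm p (msum n m (\<lambda>k. mat_abs (A k)))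
        \<longrightarrow> m \<le> n)"
proof (intro conjI allI impI; (elim conjE)?)
  note p = assms(2) and m = assms(1)
  fix n :: nat and A :: "nat \<Rightarrow> complex mat"
  assume fam: "rank_one_family n m A"
  show "schatten_norm p (msum n m A) \<le> tz_const p m * schatten_norm p (msum n m (\<lambda>k. mat_abs (A k)))"
    by (rule rank_one_family_bound(1)[OF p m fam])
  show "schatten_norm p (msum n m A) = tz_const p m * schatten_norm p (msum n m (\<lambda>k. mat_abs (A k)))
      \<longleftrightarrow> tz_extremal p n m A"
    using rank_one_family_bound(3)[OF p m fam] tz_extremal_imp_equality[OF p m] by blast
  show "m \<le> n"
    if "schatten_norm p (msum n m A) = tz_const p m * schatten_norm p (msum n m (\<lambda>k. mat_abs (A k)))"
    using rank_one_family_bound(3)[OF p m fam that] ..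
next
  note p = assms(2) and m = assms(1)
  have attained: "\<exists>A. rank_one_family n m A \<and>
      schatten_norm p (msum n m A) = tz_const p m * schatten_norm p (msum n m (\<lambda>k. mat_abs (A k)))"
    if "n \<ge> m" for n
    using tz_extremal_exists[OF p m that] tz_extremal_rank_one_family[of m p n]
      tz_extremal_imp_equality[OF p m] m by fastforce
  show "\<exists>A. rank_one_family n m A \<and>
      schatten_norm p (msum n m A) = tz_const p m * schatten_norm p (msum n m (\<lambda>k. mat_abs (A k)))"
    if "n \<ge> m" for n
    using that by (rule attained)
  fix c :: real
  assume c: "\<forall>n\<ge>1. \<forall>A. rank_one_family n m A \<longrightarrow>
      schatten_norm p (msum n m A) \<le> c * schatten_norm p (msum n m (\<lambda>k. mat_abs (A k)))"
  obtain A where fam: "rank_one_family m m A" and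
    eq: "schatten_norm p (msum m m A) = tz_const p m * schatten_norm p (msum m m (\<lambda>k. mat_abs (A k)))"
    using attained[of m] by blast
  have "schatten_norm p (msum m m A) \<le> c * schatten_norm p (msum m m (\<lambda>k. mat_abs (A k)))"
    using c fam m by simp
  thus "tz_const p m \<le> c"
    unfolding eq using rank_one_family_bound(2)[OF p m fam] by simp
qed

end
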